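(* Let $q>2$ be a prime, $n\ge 2$, $a\in\mathbb{Z}_q$, and let $f:\mathbb{Z}_q^n\to\mathbb{Z}_q$ be a quadratic function. If all $(n-1)$-ary retracts of the $n$-ary quasigroup $Q_{f,a}$ of order $q^2$ are separable, then the quasigroup $Q_{f,a}$ itself is separable.
   Context: A function $f:\mathbb{Z}_q^n\to\mathbb{Z}_q$ is quadratic if it is represented by a polynomial over $\mathbb{Z}_q$ of degree at most $2$. An $n$-ary quasigroup on a set $\Sigma$ (of order $|\Sigma|$) is an operation $Q:\Sigma^n\to\Sigma$ such that in the equation $x_0=Q(x_1,\ldots,x_n)$ the values of any $n$ of the variables $x_0,\ldots,x_n$ uniquely determine the value of the remaining one. The inverse of $Q$ in the $i$-th place, $Q^{(i)}$, is the $n$-ary quasigroup for which $x_0=Q(x_1,\ldots,x_n)$ is equivalent to $x_i=Q^{(i)}(x_1,\ldots,x_{i-1},x_0,x_{i+1},\ldots,x_n)$. A retract of $Q$ of arity $n-k$ is an $(n-k)$-ary quasigroup obtained from $Q$ or from some $Q^{(i)}$, $i\in\{1,\ldots,n\}$, by substituting constants for some $k$ arguments. For nonempty $W\subset\{1,\ldots,n\}$, $Q$ is $W$-separable if $Q(\bar x)=G(\bar x',H(\bar x''))$ for some $|W|$-ary quasigroup $H$ and some $(n-|W|+1)$-ary quasigroup $G$ on $\Sigma$, where $\bar x''$ is the tuple of variables from $\bar x=(x_1,\ldots,x_n)$ with indices in $W$ and $\bar x'$ is the tuple of all other variables. An $n$-ary quasigroup is separable if it is $W$-separable for some $W\subset\{1,\ldots,n\}$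 with $2\le|W|\le n-1$ (equivalently, it is $W$-separable with both quasigroups $G,H$ of arity less than $n$). Let $\Sigma=\{[x,y]\mid x,y\in\mathbb{Z}_q\}$. For $f:\mathbb{Z}_q^n\to\mathbb{Z}_q$ and $a\in\mathbb{Z}_q$, $$Q_{f,a}([x_1,y_1],\ldots,[x_n,y_n])=\Big[-\sum_{i=1}^n x_i+a,\ -\sum_{i=1}^n y_i+f(x_1,\ldots,x_n)\Big].$$ *)

theory Defs
  imports
    "Berlekamp_Zassenhaus.Finite_Field"
    "HOL-Library.Poly_Mapping"
begin

section \<open>Quasigroups of arbitrary arity\<close>

text \<open>
  An n-tuple over a set is a list of length n, with coordinates numbered from 0 to n - 1.
  The underlying set of a quasigroup is a whole type.  An n-ary operation is a function on lists
  whose values are relevant only on lists of length n.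
\<close>

text \<open>
  In the equation x0 = Q(x1,...,xn), the operation Q determines x0 by itself, so only the
  solvability for each of the arguments has to be required.
\<close>

definition nary_quasigroup :: "nat \<Rightarrow> ('a list \<Rightarrow> 'a) \<Rightarrow> bool" where
  "nary_quasigroup n Q \<longleftrightarrow>
     (\<forall>xs x0 i. length xs = n \<and> i < n \<longrightarrow> (\<exists>!v. x0 = Q (xs[i := v])))"

definition is_inverse_at :: "nat \<Rightarrow> nat \<Rightarrow> ('a list \<Rightarrow> 'a) \<Rightarrow> ('a list \<Rightarrow> 'a) \<Rightarrow> bool" where
  "is_inverse_at n i Q Q' \<longleftrightarrow>
     nary_quasigroup n Q' \<and>
     (\<forall>xs x0. length xs = n \<longrightarrow> (x0 = Q xs \<longleftrightarrow> xs ! i = Q' (xs[i := x0])))"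

text \<open>
  In the next two definitions, \<open>nths xs I\<close> is the tuple of those entries of \<open>xs\<close>
  whose index lies in \<open>I\<close>, in their original order.  Substituting the constants \<open>c i\<close> for the
  arguments of \<open>Q'\<close> with index in a k-element set \<open>K\<close> leaves an operation \<open>R\<close> in the other
  n - k arguments.
\<close>

definition is_retract :: "nat \<Rightarrow> nat \<Rightarrow> ('a list \<Rightarrow> 'a) \<Rightarrow> ('a list \<Rightarrow> 'a) \<Rightarrow> bool" where
  "is_retract n k Q R \<longleftrightarrow>
     (\<exists>Q' K c.
        (Q' = Q \<or> (\<exists>i<n. is_inverse_at n i Q Q')) \<and>
        K \<subseteq> {..<n} \<and> card K = k \<and>
        (\<forall>xs. length xs = n \<and> (\<forall>i\<in>K. xs ! i = c i) \<longrightarrow> R (nths xs (- K)) = Q' xs))"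

definition W_separable :: "nat \<Rightarrow> nat set \<Rightarrow> ('a list \<Rightarrow> 'a) \<Rightarrow> bool" where
  "W_separable n W Q \<longleftrightarrow>
     (\<exists>G H. nary_quasigroup (card W) H \<and> nary_quasigroup (n - card W + 1) G \<and>
        (\<forall>xs. length xs = n \<longrightarrow> Q xs = G (nths xs (- W) @ [H (nths xs W)])))"

definition separable :: "nat \<Rightarrow> ('a list \<Rightarrow> 'a) \<Rightarrow> bool" where
  "separable n Q \<longleftrightarrow>
     (\<exists>W \<subseteq> {..<n}. 2 \<le> card W \<and> card W \<le> n - 1 \<and> W_separable n W Q)"


section \<open>Quadratic functions\<close>

text \<open>
  A polynomial in variables indexed by natural numbers is a finitely supported map from exponent
  vectors to coefficients.
\<close>

type_synonym 'a multi_poly = "(nat \<Rightarrow>\<^sub>0 nat) \<Rightarrow>\<^sub>0 'a"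

definition eval_multi_poly :: "'a::comm_semiring_1 multi_poly \<Rightarrow> 'a list \<Rightarrow> 'a" where
  "eval_multi_poly p xs =
     (\<Sum>m\<in>Poly_Mapping.keys p.
        Poly_Mapping.lookup p m *
        (\<Prod>i\<in>Poly_Mapping.keys m. (xs ! i) ^ Poly_Mapping.lookup m i))"

definition quadratic :: "nat \<Rightarrow> ('a::comm_semiring_1 list \<Rightarrow> 'a) \<Rightarrow> bool" where
  "quadratic n f \<longleftrightarrow>
     (\<exists>p :: 'a multi_poly.
        (\<forall>m\<in>Poly_Mapping.keys p.
           Poly_Mapping.keys m \<subseteq> {..<n} \<and>
           (\<Sum>i\<in>Poly_Mapping.keys m. Poly_Mapping.lookup m i) \<le> 2) \<and>
        (\<forall>xs. length xs = n \<longrightarrow> f xs = eval_multi_poly p xs))"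


section \<open>The quasigroups built from a function\<close>

text \<open>
  The pair \<open>(x, y)\<close> stands for the element [x, y].  The arity is the length of the argument.
\<close>

definition Q_op ::
  "('a::comm_ring list \<Rightarrow> 'a) \<Rightarrow> 'a \<Rightarrow> ('a \<times> 'a) list \<Rightarrow> 'a \<times> 'a" where
  "Q_op f a zs =
     (- sum_list (map fst zs) + a, - sum_list (map snd zs) + f (map fst zs))"

lemma nary_quasigroup_Q_op: "nary_quasigroup n (Q_op f a)"
  unfolding nary_quasigroup_def
proof (intro allI impI)
  fix xs :: "('a \<times> 'a) list" and x0 :: "'a \<times> 'a" and i
  assume *: "length xs = n \<and> i < n"
  have upd: "sum_list (ys[i := v]) = sum_list ys - ys ! i + v"
    if "length ys = n" for ys :: "'a list" and v
  proof -
    have "i < length ys" using that * by simp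
    then show ?thesis
      by (induction ys arbitrary: i) (auto split: nat.split simp: algebra_simps)
  qed
  let ?X = "map fst xs" and ?Y = "map snd xs"
  define u where "u = a - fst x0 - sum_list ?X + ?X ! i"
  define w where "w = f (?X[i := u]) - snd x0 - sum_list ?Y + ?Y ! i"
  have eq: "Q_op f a (xs[i := v]) =
      (- (sum_list ?X - ?X ! i + fst v) + a,
       - (sum_list ?Y - ?Y ! i + snd v) + f (?X[i := fst v]))" for v
    using * by (simp add: Q_op_def map_update upd del: nth_map)
  show "\<exists>!v. x0 = Q_op f a (xs[i := v])"
  proof (rule ex1I[of _ "(u, w)"])
    show "x0 = Q_op f a (xs[i := (u, w)])"
      unfolding eq by (simp add: u_def w_def prod_eq_iff)
  next
    fix v assume v: "x0 = Q_op f a (xs[i := v])"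
    have 1: "fst v = u"
      using v unfolding eq by (simp add: u_def prod_eq_iff)
    have "snd v = w"
      using v unfolding eq by (simp add: w_def prod_eq_iff 1)
    with 1 show "v = (u, w)" by (simp add: prod_eq_iff)
  qed
qed

end

theory Submission
  imports Defs
begin

text \<open>
  Write \<open>x\<^sub>n\<close> for the first component of the value, so that the first components satisfy the
  symmetric relation \<open>x\<^sub>0 + \<dots> + x\<^sub>n = a\<close>.  For indices \<open>i \<noteq> j\<close> below \<open>n\<close> let \<open>d i j\<close> be the
  coefficient of \<open>x\<^sub>i x\<^sub>j\<close> in \<open>f\<close>, and let \<open>d\<close> vanish when one index is \<open>n\<close>.  This is a weighting of
  the edges of the complete graph on \<open>{0..n}\<close>, and separability is a property of this graph: a
  partition of \<open>{0..n}\<close> into two parts, each with at least two vertices, is a split if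
  \<open>d i j - d i' j - d i j' + d i' j' = 0\<close> whenever \<open>i, i'\<close> lie in one part and \<open>j, j'\<close> in the other.
  If \<open>n\<close> is in the first part, this says that \<open>d i j\<close> does not depend on \<open>j\<close> in the second part \<open>W\<close>,
  so all terms of \<open>f\<close> that mix \<open>W\<close> with its complement involve the variables of \<open>W\<close> only through
  their sum, and \<open>Q_op f a\<close> is \<open>W\<close>-separable (\<open>W_separable_Q_op\<close>).  Conversely, separability
  forces certain second differences to vanish (\<open>Q_op_separable_differences\<close>).  Fixing an argument
  deletes a vertex of the graph.  Fixing the value, that is, an argument of an inverse, deletes the
  vertex \<open>n\<close>; then another index \<open>n - 1\<close> becomes the output, and the expression above does
  not notice this change of the distinguished vertex.

  It remains to prove a statement on weighted complete graphs over a group without 2-torsion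
  (\<open>prime_set_removable\<close>): if a graph on at least five vertices has no split, then some vertex can
  be deleted so that there is still no split.  A graph without split contains a splitless set of
  four vertices (\<open>prime_contains_four\<close>), and splitless proper subsets can be enlarged by one or two
  vertices if they have at least four (\<open>prime_step_up\<close>).  So either a suitable single vertex
  exists, or there is a pair of vertices whose deletion leaves a splitless graph.  If no single
  vertex works, such a pair propagates to a cyclic sequence \<open>c\<close> in which \<open>c i\<close> and \<open>c (i + 2)\<close> are indistinguishable
  except by \<open>c (i + 1)\<close>.  Following the weights around the cycle gives a contradiction.  Only when
  the cycle has odd length and runs through all vertices does the contradiction take the form
  \<open>2 \<delta> = 0\<close> with \<open>\<delta> \<noteq> 0\<close>; the other use of odd characteristic is in the four-vertex statement,
  where a path with two weights has the three matching sums \<open>2 c\<close>, \<open>c + c'\<close>, \<open>2 c'\<close>.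
\<close>

section \<open>Splits of weighted complete graphs\<close>

text \<open>
  The diagonal is arbitrary: for a quadratic form it holds the square terms, which splits ignore.
\<close>

locale edge_weights =
  fixes d :: "'v \<Rightarrow> 'v \<Rightarrow> 'g::ab_group_add"
  assumes sym: "d i j = d j i"
    and no_2_torsion: "x + x = (0::'g) \<Longrightarrow> x = 0"
begin

text \<open>
  The cross difference does not change when \<open>u i + v j\<close> is added to \<open>d i j\<close>, and it is additive
  in the pair \<open>i, i'\<close> and in the pair \<open>j, j'\<close>.
\<close>

definition cross :: "'v \<Rightarrow> 'v \<Rightarrow> 'v \<Rightarrow> 'v \<Rightarrow> 'g" where
  "cross i i' j j' = d i j - d i' j - d i j' + d i' j'"

lemma cross_swap: "cross i i' j j' = cross j j' i i'"
  unfolding cross_def by (simp add: sym[of j] sym[of j'])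

lemma cross_chain: "cross i i'' j j' = cross i i' j j' + cross i' i'' j j'"
  unfolding cross_def by simp

lemma cross_chain': "cross i i' j j'' = cross i i' j j' + cross i i' j' j''"
  unfolding cross_def by simp

lemma cross_flip: "cross i' i j j' = - cross i i' j j'"
  unfolding cross_def by simp

lemma cross_flip': "cross i i' j' j = - cross i i' j j'"
  unfolding cross_def by simp

lemma cross_same [simp]: "cross i i j j' = 0" "cross i i' j j = 0"
  unfolding cross_def by simp_all

definition split :: "'v set \<Rightarrow> 'v set \<Rightarrow> bool" where
  "split V A \<longleftrightarrow> A \<subseteq> V \<and> 2 \<le> card A \<and> 2 \<le> card (V - A) \<and>
     (\<forall>i\<in>A. \<forall>i'\<in>A. \<forall>j\<in>V - A. \<forall>j'\<in>V - A. cross i i' j j' = 0)"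

text \<open>
  The name is that of split decomposition theory.  On fewer than four vertices no
  partition qualifies as a split, so such sets are excluded.
\<close>

definition prime_set :: "'v set \<Rightarrow> bool" where
  "prime_set V \<longleftrightarrow> finite V \<and> 4 \<le> card V \<and> (\<nexists>A. split V A)"

definition twins :: "'v set \<Rightarrow> 'v \<Rightarrow> 'v \<Rightarrow> bool" where
  "twins V u v \<longleftrightarrow> u \<in> V \<and> v \<in> V \<and> u \<noteq> v \<and>
     (\<forall>j\<in>V - {u, v}. \<forall>j'\<in>V - {u, v}. cross u v j j' = 0)"

lemma splitI:
  assumes "A \<subseteq> V" "2 \<le> card A" "2 \<le> card (V - A)"
    and z: "\<And>i j j'. i \<in> V - A \<Longrightarrow> j \<in> A \<Longrightarrow> j' \<in> A \<Longrightarrow> cross i p j j' = 0"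
  shows "split V A"
proof -
  have "cross i i' j j' = 0" if "i \<in> A" "i' \<in> A" "j \<in> V - A" "j' \<in> V - A" for i i' j j'
    using z[OF that(3,1,2)] z[OF that(4,1,2)] cross_swap[of i i' j j'] cross_chain[of j j' i i' p]
      cross_flip[of p j' i i'] by simp
  then show ?thesis using assms unfolding split_def by blast
qed

lemma split_compl:
  assumes "split V A"
  shows "split V (V - A)"
proof -
  have "V - (V - A) = A" using assms unfolding split_def by auto
  then show ?thesis using assms unfolding split_def by (metis Diff_subset cross_swap)
qed

lemma split_restrict:
  assumes "split V A" "X \<subseteq> V" "2 \<le> card (A \<inter> X)" "2 \<le> card (X - A)"
  shows "split X (A \<inter> X)"
proof -
  have e: "X - A \<inter> X = X - A" by auto
  have "\<forall>i\<in>A \<inter> X. \<forall>i'\<in>A \<inter> X. \<forall>j\<in>X - A. \<forall>j'\<in>X - A. cross i i' j j' = 0"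
    using assms(1,2) unfolding split_def by blast
  then show ?thesis using assms e unfolding split_def by auto
qed

lemma two_le_card:
  assumes "x \<in> S" "y \<in> S" "x \<noteq> y" "finite S"
  shows "2 \<le> card S"
  using card_mono[of S "{x, y}"] assms by auto

lemma two_le_cardE:
  assumes "2 \<le> card S"
  obtains x y where "x \<in> S" "y \<in> S" "x \<noteq> y"
proof -
  have "\<not> card S \<le> Suc 0" using assms by simp
  moreover have "finite S" using assms by (metis card.infinite not_numeral_le_zero)
  ultimately show thesis using that card_le_Suc0_iff_eq by blast
qed

lemma twins_split:
  assumes "twins V u v" "finite V" "4 \<le> card V"
  shows "split V {u, v}"
proof -
  have uv: "{u, v} \<subseteq> V" "card {u, v} = 2" using assms unfolding twins_def by auto
  then have "card (V - {u, v}) = card V - 2"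
    by (metis card_Diff_subset finite.emptyI finite_insert)
  then have "2 \<le> card (V - {u, v})" using assms by simp
  then show ?thesis
    using assms uv unfolding split_def twins_def by (auto simp: cross_flip[of v u])
qed

lemma prime_not_twins: "prime_set V \<Longrightarrow> \<not> twins V u v"
  using twins_split unfolding prime_set_def by blast

text \<open>
  A split of \<open>V\<close> cuts a prime subset in a trivial way, since otherwise it would induce a split there.
\<close>

lemma prime_split_small:
  assumes X: "prime_set X" and XV: "X \<subseteq> V" and s: "split V A"
  obtains B u where "split V B" "B \<inter> X \<subseteq> {u}" "u \<in> X"
proof -
  have fin: "finite X" and X0: "X \<noteq> {}" using X unfolding prime_set_def by auto
  have "\<not> split X (A \<inter> X)" using X unfolding prime_set_def by auto
  then have "card (A \<inter> X) < 2 \<or> card (X - A) < 2" using split_restrict[OF s XV] by linarith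
  then have "card (A \<inter> X) \<le> Suc 0 \<or> card ((V - A) \<inter> X) \<le> Suc 0"
  proof -
    have "(V - A) \<inter> X = X - A" using XV by auto
    with \<open>card (A \<inter> X) < 2 \<or> card (X - A) < 2\<close> show ?thesis by auto
  qed
  moreover have *: "\<exists>u\<in>X. B \<inter> X \<subseteq> {u}" if "card (B \<inter> X) \<le> Suc 0" for B
  proof (cases "B \<inter> X = {}")
    case False
    then obtain u where "u \<in> B \<inter> X" by blast
    moreover have "p = u" if "p \<in> B \<inter> X" for p
      using card_le_Suc0_iff_eq[of "B \<inter> X"] \<open>card (B \<inter> X) \<le> Suc 0\<close> fin that calculation by blast
    ultimately show ?thesis by blast
  qed (use X0 in auto)
  ultimately show thesis using that s split_compl[OF s] by metis
qed

section \<open>Enlarging prime sets\<close>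

lemma twin_exists:
  assumes X: "prime_set X" and x: "x \<notin> X" and np: "\<not> prime_set (insert x X)"
  obtains u where "u \<in> X" "twins (insert x X) x u"
proof -
  have fin: "finite X" and c: "4 \<le> card X" using X unfolding prime_set_def by auto
  obtain A where "split (insert x X) A"
    using np X x unfolding prime_set_def by auto
  then obtain B u where B: "split (insert x X) B" "B \<inter> X \<subseteq> {u}" "u \<in> X"
    using prime_split_small[OF X] by blast
  obtain p q where "p \<in> B" "q \<in> B" "p \<noteq> q" using B(1) two_le_cardE unfolding split_def by metis
  then have "B = {x, u}" using B unfolding split_def by blast
  then have "twins (insert x X) x u"
    using B x unfolding split_def twins_def by auto
  then show thesis using that B(3) by blast
qed

lemma twin_unique:
  assumes X: "prime_set X" and x: "x \<notin> X"
    and u: "twins (insert x X) x u" and v: "twins (insert x X) x v"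
  shows "u = v"
proof (rule ccontr)
  assume ne: "u \<noteq> v"
  have uX: "u \<in> X" "v \<in> X" using u v unfolding twins_def by auto
  have "cross u v j j' = 0" if "j \<in> X - {u, v}" "j' \<in> X - {u, v}" for j j'
    using u v that x cross_chain[of u v j j' x]
    unfolding twins_def by (auto simp: cross_flip[of u x])
  then have "twins X u v" using ne uX unfolding twins_def by blast
  then show False using prime_not_twins[OF X] by blast
qed

text \<open>
  Twins are interchangeable: a split after deleting one of them turns into a split after deleting
  the other when the remaining twin is replaced.
\<close>

lemma prime_swap_twin:
  assumes tw: "twins Y a a'" and p: "prime_set (Y - {a})"
  shows "prime_set (Y - {a'})"
proof -
  have aa: "a \<in> Y" "a' \<in> Y" "a \<noteq> a'" using tw unfolding twins_def by auto
  have fin: "finite Y" using p unfolding prime_set_def by auto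
  have "False" if s0: "split (Y - {a'}) A" for A
  proof -
    obtain B where B: "split (Y - {a'}) B" "a \<in> B"
      using s0 split_compl[OF s0] aa by (cases "a \<in> A") auto
    define B' where "B' = insert a' (B - {a})"
    have BY: "B \<subseteq> Y - {a'}" using B unfolding split_def by auto
    have co: "(Y - {a}) - B' = (Y - {a'}) - B" unfolding B'_def using B aa BY by auto
    have "card B' = card B" unfolding B'_def using BY B(2) fin finite_subset[OF BY]
      by (subst card_insert_disjoint) (auto simp: card_Suc_Diff1 simp del: card_Diff_insert)
    moreover have a0: "cross a' a j j' = 0" if "j \<in> Y - {a'} - B" "j' \<in> Y - {a'} - B" for j j'
      using tw that B(2) cross_flip[of a' a j j'] unfolding twins_def by auto
    moreover have "cross i i' j j' = 0"
      if "i \<in> B'" "i' \<in> B'" and j: "j \<in> Y - {a'} - B" "j' \<in> Y - {a'} - B" for i i' j j'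
    proof -
      have z: "cross k a j j' = 0" if "k \<in> B'" for k
        using that a0[OF j] B j unfolding B'_def split_def by blast
      show ?thesis using z[OF that(1)] z[OF that(2)] cross_chain[of i i' j j' a] cross_flip[of a i' j j']
        by simp
    qed
    moreover have "B' \<subseteq> Y - {a}" unfolding B'_def using BY aa by auto
    ultimately have "split (Y - {a}) B'" using B co unfolding split_def by auto
    then show False using p unfolding prime_set_def by blast
  qed
  moreover have "card (Y - {a'}) = card (Y - {a})" using aa fin by simp
  ultimately show ?thesis using p fin unfolding prime_set_def by auto
qed

text \<open>
  If \<open>x\<close> and \<open>y\<close> copy different vertices \<open>u\<close> and \<open>v\<close> of \<open>X\<close>, then a split of the whole could
  only have \<open>{x, u}\<close> or \<open>{y, v}\<close> as a part, and both possibilities are excluded by the same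
  nonzero cross difference.
\<close>

lemma prime_extend_two:
  assumes X: "prime_set X" and x: "x \<notin> X" "twins (insert x X) x u"
    and y: "y \<notin> X" "twins (insert y X) y v"
    and uv: "u \<noteq> v" and xy: "x \<noteq> y" and cr: "cross x u y v \<noteq> 0"
  shows "prime_set (insert x (insert y X))"
proof -
  let ?Y = "insert x (insert y X)"
  have fin: "finite X" and c: "4 \<le> card X" using X unfolding prime_set_def by auto
  have uX: "u \<in> X" "v \<in> X" using x y unfolding twins_def by auto
  have nsplit: "\<not> split ?Y A" for A
  proof
    assume "split ?Y A"
    then obtain B w where B: "split ?Y B" "B \<inter> X \<subseteq> {w}" "w \<in> X"
      using prime_split_small[OF X, of ?Y A] by blast
    have BY: "B \<subseteq> ?Y" using B unfolding split_def by auto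
    have key: "cross i i' j j' = 0" if "i \<in> B" "i' \<in> B" "j \<in> ?Y - B" "j' \<in> ?Y - B" for i i' j j'
      using B that unfolding split_def by blast
    have tw: "w = t" if "z \<in> B" "w \<in> B" and z: "z \<notin> X" "twins (insert z X) z t" for z t
    proof -
      have "twins (insert z X) z w"
        unfolding twins_def
      proof (intro conjI ballI)
        fix j j' assume "j \<in> insert z X - {z, w}" "j' \<in> insert z X - {z, w}"
        then show "cross z w j j' = 0" using B(2) that by (intro key) auto
      qed (use B z in auto)
      then show ?thesis using twin_unique[OF X z(1)] z(2) by blast
    qed
    obtain p q where pq: "p \<in> B" "q \<in> B" "p \<noteq> q"
      using B(1) two_le_cardE unfolding split_def by metis
    show False
    proof (cases "w \<in> B")
      case True
      show False
      proof (cases "x \<in> B")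
        case xB: True
        then have wu: "w = u" using tw[of x u] True x by auto
        show False
        proof (cases "y \<in> B")
          case True
          then show False using tw[of y v] \<open>w \<in> B\<close> y wu uv by auto
        next
          case False
          have "cross x u y v = 0" using True xB False B(2) wu uv uX by (intro key) auto
          then show False using cr by simp
        qed
      next
        case xB: False
        then have yB: "y \<in> B" using pq BY B(2) by auto
        then have wv: "w = v" using tw[of y v] True y by auto
        have "cross y v x u = 0" using True xB yB B(2) wv uv uX by (intro key) auto
        then show False using cr cross_swap by metis
      qed
    next
      case False
      then have Bxy: "B = {x, y}" using pq BY B(2) by auto
      have "twins (insert y X) y u"
        unfolding twins_def
      proof (intro conjI ballI)
        fix j j' assume jj: "j \<in> insert y X - {y, u}" "j' \<in> insert y X - {y, u}"
        then have "cross y x j j' = 0" using x y Bxy by (intro key) auto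
        moreover have "cross x u j j' = 0" using x(1) x(2) jj unfolding twins_def by auto
        ultimately show "cross y u j j' = 0" using cross_chain[of y u j j' x] by simp
      qed (use uX y in auto)
      then show False using twin_unique[OF X y(1)] y(2) uv by blast
    qed
  qed
  have "card X \<le> card ?Y" using fin by (intro card_mono) auto
  then show ?thesis using nsplit fin c unfolding prime_set_def by auto
qed

text \<open>
  If no single vertex can be added to \<open>X\<close>, every outside vertex is a twin of a vertex of \<open>X\<close>.
  The vertices that belong to one \<open>u\<close> in \<open>X\<close>, together with \<open>u\<close>, are not a part of a split
  of \<open>V\<close>; a violation is seen by an outside vertex belonging to another vertex of \<open>X\<close>, and this
  is the pair for \<open>prime_extend_two\<close>.
\<close>

lemma prime_step_up:
  assumes V: "prime_set V" and X: "prime_set X" "X \<subset> V"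
  obtains Y where "prime_set Y" "X \<subset> Y" "Y \<subseteq> V" "card Y \<le> card X + 2"
proof -
  have finX: "finite X" and c: "4 \<le> card X" and finV: "finite V"
    using X V unfolding prime_set_def by auto
  show thesis
  proof (cases "\<exists>x\<in>V - X. prime_set (insert x X)")
    case True
    then obtain x where "x \<in> V - X" "prime_set (insert x X)" by blast
    then show thesis using that[of "insert x X"] X finX by (auto simp: card_insert_if)
  next
    case False
    define t where "t x = (SOME u. twins (insert x X) x u)" for x
    have t: "twins (insert x X) x (t x)" "t x \<in> X" if "x \<in> V - X" for x
    proof -
      have "\<exists>u. twins (insert x X) x u" using twin_exists[OF X(1), of x] False that by blast
      then show "twins (insert x X) x (t x)" unfolding t_def by (rule someI_ex)
      then show "t x \<in> X" unfolding twins_def using that by auto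
    qed
    obtain x0 where x0: "x0 \<in> V - X" using X by auto
    define u where "u = t x0"
    define A where "A = insert u {x \<in> V - X. t x = u}"
    have uX: "u \<in> X" using t x0 unfolding u_def by auto
    have AX: "A \<inter> X = {u}" "A \<subseteq> V" using uX X unfolding A_def by auto
    have tA: "cross x u j j' = 0" if "x \<in> A" "j \<in> X - {u}" "j' \<in> X - {u}" for x j j'
      using that t[of x] unfolding A_def twins_def by auto
    have "\<not> split V A" using V unfolding prime_set_def by blast
    moreover have "2 \<le> card A"
      using x0 uX finV unfolding A_def u_def by (intro two_le_card[of u _ x0]) (auto simp: u_def)
    moreover have "2 \<le> card (V - A)"
    proof -
      have "card (X - {u}) \<le> card (V - A)" using AX X finV by (intro card_mono) auto
      then show ?thesis using c uX finX by simp
    qed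
    ultimately obtain i i' j j' where ij: "i \<in> A" "i' \<in> A" "j \<in> V - A" "j' \<in> V - A" "cross i i' j j' \<noteq> 0"
      using AX unfolding split_def by blast
    have "\<exists>x\<in>A. cross x u j j' \<noteq> 0"
      using ij cross_chain[of i i' j j' u] cross_flip[of u i' j j'] by (metis add.right_neutral minus_zero)
    then obtain x where x: "x \<in> A" "cross x u j j' \<noteq> 0" by blast
    have "card (X - {u}) \<noteq> 0" using c uX finX by auto
    then have "X - {u} \<noteq> {}" by force
    then obtain w where w: "w \<in> X - {u}" by blast
    have "\<exists>y\<in>V - A. cross x u y w \<noteq> 0"
      using x ij cross_chain'[of x u j j' w] cross_flip'[of x u w j'] by (metis add.right_neutral minus_zero)
    then obtain y where y: "y \<in> V - A" "cross x u y w \<noteq> 0" by blast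
    have yX: "y \<notin> X" using tA[OF x(1), of y w] y w AX by blast
    define v where "v = t y"
    have v: "v \<in> X" "v \<noteq> u" "twins (insert y X) y v"
      using t[of y] y yX unfolding v_def A_def by auto
    have xX: "x \<in> V - X" using x unfolding A_def by auto
    have "cross x u y v \<noteq> 0"
      using y(2) cross_chain'[of x u y w v] tA[OF x(1), of v w] v w by auto
    then have "prime_set (insert x (insert y X))"
      using prime_extend_two[OF X(1), of x u y v] t[OF xX] xX x yX v y unfolding A_def by auto
    moreover have "X \<subset> insert x (insert y X)" "insert x (insert y X) \<subseteq> V"
      using X(2) xX y(1) by auto
    moreover have "card (insert x (insert y X)) \<le> card X + 2"
      using finX by (simp add: card_insert_if)
    ultimately show thesis using that by blast
  qed
qed

section \<open>Prime sets of four vertices\<close>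

text \<open>
  Subtracting the weights towards \<open>b\<close> leaves all cross differences unchanged and gives all edges
  at \<open>b\<close> the same weight, so that cross differences that involve \<open>b\<close> become plain differences.
\<close>

definition based :: "'v \<Rightarrow> 'v \<Rightarrow> 'v \<Rightarrow> 'g" where
  "based b p q = d p q - d p b - d q b"

lemma based_sym: "based b p q = based b q p"
  unfolding based_def by (simp add: sym[of p q])

lemma cross_based: "cross i i' j j' = based b i j - based b i' j - based b i j' + based b i' j'"
  unfolding cross_def based_def by simp

lemma cross_base: "cross i i' j b = based b i j - based b i' j"
  unfolding cross_def based_def by simp

text \<open>
  The three splits of four vertices correspond to the equalities between the three sums
  \<open>d w x + d y z\<close>, \<open>d w y + d x z\<close>, \<open>d w z + d x y\<close>.
\<close>

lemma not_prime_four: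
  assumes "distinct [w, x, y, z]" "\<not> prime_set {w, x, y, z}"
  shows "cross w x y z = 0 \<or> cross w y x z = 0 \<or> cross w z x y = 0"
proof -
  obtain A where s0: "split {w, x, y, z} A" using assms unfolding prime_set_def by auto
  obtain A where s: "split {w, x, y, z} A" "w \<in> A"
    using s0 split_compl[OF s0] by (cases "w \<in> A") auto
  obtain i i' where i: "i \<in> A" "i' \<in> A" "i \<noteq> i'"
    using s two_le_cardE unfolding split_def by metis
  obtain j j' where j: "j \<in> {w, x, y, z} - A" "j' \<in> {w, x, y, z} - A" "j \<noteq> j'"
    using s two_le_cardE unfolding split_def by metis
  obtain k where k: "k \<in> A" "k \<noteq> w" using i by metis
  have "cross w k j j' = 0" "cross w k j' j = 0" using s k j unfolding split_def by auto
  moreover have "k \<in> {x, y, z}" "j \<in> {x, y, z}" "j' \<in> {x, y, z}" "k \<noteq> j" "k \<noteq> j'"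
    using s k j unfolding split_def by auto
  ultimately show ?thesis using j(3) by auto
qed

lemma not_prime_triangle:
  assumes "distinct [b, x, y, z]" "\<not> prime_set {b, x, y, z}"
  shows "based b x y = based b x z \<or> based b x y = based b y z \<or> based b x z = based b y z"
proof -
  have "cross x y z b = 0 \<or> cross x z y b = 0 \<or> cross x b y z = 0"
    using not_prime_four[of x y z b] assms by (auto simp: insert_commute)
  moreover have "cross x b y z = cross y z x b" by (rule cross_swap)
  ultimately show ?thesis
    by (auto simp: cross_base based_sym[of b y x] based_sym[of b z x] based_sym[of b z y])
qed

text \<open>
  Think of \<open>based b\<close> as an edge colouring of \<open>U\<close>.  Without prime sets of four vertices there is no
  triangle with three colours (use \<open>b\<close> as fourth vertex), and no path on four vertices of one
  colour whose three other edges have a second common colour.  For a new vertex \<open>x\<close> and a cut \<open>A\<close> of \<open>U\<close> in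
  the colour \<open>c\<close>, either \<open>x\<close> can be put on one of the two sides, or \<open>x\<close> sends edges of another
  colour to both sides.  In the latter case all these edges have one colour \<open>c'\<close>, and the set \<open>T\<close>
  of vertices joined to \<open>x\<close> in colour \<open>c\<close> is cut off in colour \<open>c\<close> from all others (if it is
  empty, \<open>{x}\<close> is cut off in colour \<open>c'\<close>): an
  edge \<open>t s\<close> of colour \<open>c'\<close> with \<open>t \<in> T\<close> would start a forbidden path \<open>t, s, x, a\<close>.
\<close>

lemma monochromatic_cut:
  assumes "finite U" "b \<notin> U" "2 \<le> card U"
    and "\<And>Y. Y \<subseteq> insert b U \<Longrightarrow> card Y = 4 \<Longrightarrow> \<not> prime_set Y"
  shows "\<exists>A c. A \<subset> U \<and> A \<noteq> {} \<and> (\<forall>p\<in>A. \<forall>q\<in>U - A. based b p q = c)"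
  using assms
proof (induction U rule: finite_induct)
  case empty
  then show ?case by simp
next
  case (insert x U)
  have four: "\<not> prime_set {p, q, r, s}" if "distinct [p, q, r, s]" "{p, q, r, s} \<subseteq> insert b (insert x U)" for p q r s
    using insert.prems(3)[OF that(2)] that(1) by simp
  have cutI: ?case if "B \<subset> insert x U" "B \<noteq> {}" "\<forall>p\<in>B. \<forall>q\<in>insert x U - B. based b p q = k" for B k
    using that by (intro exI[of _ B] exI[of _ k]) simp
  show ?case
  proof (cases "2 \<le> card U")
    case False
    then have "card U = 1" using insert by simp
    then obtain y where y: "U = {y}" by (auto simp: card_1_singleton_iff)
    then show ?thesis using insert by (intro exI[of _ "{x}"] exI[of _ "based b x y"]) auto
  next
    case True
    have "\<exists>A c. A \<subset> U \<and> A \<noteq> {} \<and> (\<forall>p\<in>A. \<forall>q\<in>U - A. based b p q = c)"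
    proof (rule insert.IH)
      fix Y assume "Y \<subseteq> insert b U" "card Y = 4"
      then show "\<not> prime_set Y" by (intro insert.prems(3)) auto
    qed (use True insert in auto)
    then obtain A c where A: "A \<subset> U" "A \<noteq> {}" "\<And>p q. p \<in> A \<Longrightarrow> q \<in> U - A \<Longrightarrow> based b p q = c"
      by blast
    then have A': "based b p q = c" if "p \<in> A \<longleftrightarrow> q \<notin> A" "p \<in> U" "q \<in> U" for p q
      using that based_sym[of b p q] by (cases "p \<in> A") auto
    let ?c = "\<lambda>p. based b x p"
    have bx: "b \<noteq> x" "b \<notin> U" using insert by auto
    consider (missA) "\<forall>p\<in>A. ?c p = c" | (missB) "\<forall>p\<in>U - A. ?c p = c"
      | (both) "\<exists>p\<in>A. ?c p \<noteq> c" "\<exists>p\<in>U - A. ?c p \<noteq> c" by blast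
    then show ?thesis
    proof cases
      case missA
      then have "\<forall>p\<in>A. \<forall>q\<in>insert x U - A. based b p q = c"
        using A insert.hyps(2) based_sym[of b x] by auto
      then show ?thesis using A insert.hyps(2) by (intro exI[of _ A]) auto
    next
      case missB
      then have "\<forall>p\<in>U - A. \<forall>q\<in>insert x U - (U - A). based b p q = c"
        using A' A(1) insert.hyps(2) based_sym[of b x] by auto
      then show ?thesis using A(1,2) insert.hyps(2) by (intro exI[of _ "U - A"]) auto
    next
      case both
      have eq: "?c p = ?c q" if "p \<in> U" "q \<in> U" "p \<in> A \<longleftrightarrow> q \<notin> A" "?c p \<noteq> c" "?c q \<noteq> c" for p q
      proof -
        have "b \<noteq> p" "b \<noteq> q" "x \<noteq> p" "x \<noteq> q" "p \<noteq> q" using that bx insert.hyps(2) by auto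
        then show ?thesis
          using not_prime_triangle[of b x p q] four[of b x p q] A'[of p q] that bx by auto
      qed
      obtain c' where c': "\<And>p. p \<in> U \<Longrightarrow> ?c p \<noteq> c \<Longrightarrow> ?c p = c'" "c' \<noteq> c"
      proof -
        obtain p q where p: "p \<in> A" "?c p \<noteq> c" and q: "q \<in> U - A" "?c q \<noteq> c" using both by blast
        then have pq: "?c p = ?c q" using eq[of p q] A(1) by auto
        have "?c r = ?c q" if "r \<in> U" "?c r \<noteq> c" for r
          using eq[of r q] eq[of r p] pq p q that A(1) by (cases "r \<in> A") auto
        then show thesis using that[of "?c q"] q(2) by blast
      qed
      have opposite: "\<exists>r\<in>U. (r \<in> A \<longleftrightarrow> p \<notin> A) \<and> ?c r = c'" for p
        using both c' A(1) by (cases "p \<in> A") auto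
      define T where "T = {t \<in> U. ?c t = c}"
      have TS: "based b t s = c" if "t \<in> T" "s \<in> U - T" for t s
      proof (rule ccontr)
        assume nc: "based b t s \<noteq> c"
        have ts: "t \<in> U" "s \<in> U" "?c t = c" "?c s = c'" "t \<noteq> s"
          using that c' unfolding T_def by auto
        have "based b t s = c'"
        proof -
          have "b \<noteq> t" "b \<noteq> s" "x \<noteq> t" "x \<noteq> s" using ts bx insert.hyps(2) by auto
          then show ?thesis
            using not_prime_triangle[of b x t s] four[of b x t s] ts nc c'(2) bx by auto
        qed
        have same: "t \<in> A \<longleftrightarrow> s \<in> A" using A'[of t s] nc ts by auto
        obtain a where a: "a \<in> U" "a \<in> A \<longleftrightarrow> t \<notin> A" "?c a = c'" using opposite[of t] by blast
        have at: "based b t a = c" "based b s a = c" using A' a ts same by auto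
        have dist: "distinct [t, s, x, a]" using ts a same insert.hyps(2) by auto
        have two: "c = c'" if "c + c = c' + c'"
          using no_2_torsion[of "c - c'"] that by (simp add: algebra_simps)
        have "cross t s x a = 0 \<or> cross t x s a = 0 \<or> cross t a s x = 0"
          using not_prime_four[OF dist] four[OF dist] ts a by auto
        moreover have "cross t s x a = c - c'" "cross t x s a = c' - c" "cross t a s x = c' + c' - (c + c)"
          unfolding cross_based[where b = b]
          using at ts a \<open>based b t s = c'\<close> based_sym[of b _ x] based_sym[of b a s]
          by (simp_all add: algebra_simps)
        ultimately show False using two c'(2) by auto
      qed
      show ?thesis
      proof (cases "T = {}")
        case True
        then have "\<forall>q\<in>U. based b x q = c'" using c' unfolding T_def by auto
        then have "\<forall>p\<in>{x}. \<forall>q\<in>insert x U - {x}. based b p q = c'" by auto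
        moreover have "{x} \<subset> insert x U" "{x} \<noteq> {}" using insert.hyps(2) A(1,2) by auto
        ultimately show ?thesis by (rule cutI[rotated 2])
      next
        case False
        have "based b p q = c" if "p \<in> T" "q \<in> insert x U - T" for p q
        proof (cases "q = x")
          case True
          then show ?thesis using that(1) based_sym[of b p x] unfolding T_def by simp
        next
          case False
          then show ?thesis using TS that by blast
        qed
        then have "\<forall>p\<in>T. \<forall>q\<in>insert x U - T. based b p q = c" by blast
        moreover have "T \<subset> insert x U" using insert.hyps(2) unfolding T_def by auto
        ultimately show ?thesis using False by (intro cutI[of T c])
      qed
    qed
  qed
qed

text \<open>
  The two sides of a monochromatic cut are sets that no vertex outside, including \<open>b\<close>, can
  resolve; one of them has at least two elements and is a part of a split.
\<close>

lemma prime_contains_four: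
  assumes V: "prime_set V"
  obtains X where "X \<subseteq> V" "card X = 4" "prime_set X"
proof (rule ccontr)
  assume "\<not> thesis"
  then have no: "\<And>Y. Y \<subseteq> V \<Longrightarrow> card Y = 4 \<Longrightarrow> \<not> prime_set Y" using that by blast
  have fin: "finite V" and c: "4 \<le> card V" using V unfolding prime_set_def by auto
  then obtain b where b: "b \<in> V" by (metis card.empty ex_in_conv not_numeral_le_zero)
  define U where "U = V - {b}"
  have U: "finite U" "b \<notin> U" "V = insert b U" "3 \<le> card U" using fin c b unfolding U_def by auto
  have "\<exists>A k. A \<subset> U \<and> A \<noteq> {} \<and> (\<forall>p\<in>A. \<forall>q\<in>U - A. based b p q = k)"
    by (rule monochromatic_cut) (use U no in simp_all)
  then obtain A k where A: "A \<subset> U" "A \<noteq> {}" "\<And>p q. p \<in> A \<Longrightarrow> q \<in> U - A \<Longrightarrow> based b p q = k"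
    by metis
  have big: "split V B" if B: "B \<subset> U" "2 \<le> card B" "\<And>p q. p \<in> B \<Longrightarrow> q \<in> U - B \<Longrightarrow> based b p q = k" for B
  proof -
    have z: "cross i i' j b = 0" if "i \<in> B" "i' \<in> B" "j \<in> V - B" for i i' j
      using B(3) that U(2,3) by (cases "j = b") (auto simp: cross_base)
    have "cross i i' j j' = 0" if "i \<in> B" "i' \<in> B" "j \<in> V - B" "j' \<in> V - B" for i i' j j'
      using z[OF that(1,2,3)] z[OF that(1,2,4)] cross_chain'[of i i' j j' b] cross_flip'[of i i' b j']
      by simp
    moreover obtain q where "q \<in> U - B" using B(1) by blast
    then have "2 \<le> card (V - B)" using U B(1) fin by (intro two_le_card[of q _ b]) auto
    ultimately show ?thesis using B U unfolding split_def by auto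
  qed
  have "2 \<le> card A \<or> 2 \<le> card (U - A)"
    using U A(1) card_Diff_subset[of A U] finite_subset[of A U] by auto
  then show False
  proof
    assume "2 \<le> card A"
    then show False using big[of A] A V unfolding prime_set_def by blast
  next
    assume 2: "2 \<le> card (U - A)"
    have "based b p q = k" if "p \<in> U - A" "q \<in> U - (U - A)" for p q
      using A(1) A(3)[of q p] that based_sym[of b p q] by auto
    then show False using big[of "U - A"] 2 A V unfolding prime_set_def by blast
  qed
qed

section \<open>Cyclic sequences of twins\<close>

text \<open>
  If the deletion of any single vertex creates a split, then the twin \<open>a'\<close> of \<open>a\<close> in
  \<open>V - {b}\<close> is another vertex linked to \<open>b\<close>.  Each vertex with a link turns out to have exactly two
  linked vertices, and these are twins once the vertex is deleted.
\<close>

definition linked :: "'v set \<Rightarrow> 'v \<Rightarrow> 'v \<Rightarrow> bool" where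
  "linked V a b \<longleftrightarrow> a \<in> V \<and> b \<in> V \<and> a \<noteq> b \<and> prime_set (V - {a, b})"

lemma linked_step:
  assumes crit: "\<And>k. k \<in> V \<Longrightarrow> \<not> prime_set (V - {k})" and ab: "linked V a b"
  shows "\<exists>a'. linked V b a' \<and> twins (V - {b}) a a'"
proof -
  have *: "insert a (V - {a, b}) = V - {b}" "a \<notin> V - {a, b}" "prime_set (V - {a, b})"
    using ab unfolding linked_def by auto
  obtain a' where a': "twins (V - {b}) a a'"
    using twin_exists[OF *(3,2)] *(1) crit ab unfolding linked_def by metis
  have "V - {b} - {a} = V - {a, b}" "V - {b} - {a'} = V - {b, a'}" by auto
  then have "prime_set (V - {b, a'})" using prime_swap_twin[OF a'] *(3) by simp
  then have "linked V b a'" using a' ab unfolding linked_def twins_def by auto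
  then show ?thesis using a' by blast
qed

text \<open>
  Twins in \<open>V - {b}\<close> that avoid \<open>a\<close> would still be twins in the prime set \<open>V - {a, b}\<close>.
\<close>

lemma linked_in_twins:
  assumes "linked V a b" "twins (V - {b}) p q"
  shows "a = p \<or> a = q"
proof (rule ccontr)
  assume "\<not> (a = p \<or> a = q)"
  then have "twins (V - {a, b}) p q" using assms(2) unfolding twins_def by auto
  then show False using assms(1) prime_not_twins unfolding linked_def by blast
qed

lemma twins_separated:
  assumes V: "prime_set V" and tw: "twins (V - {b}) p q" and j: "b \<in> V" "j \<in> V - {b, p, q}"
  shows "cross p q b j \<noteq> 0"
proof
  assume b0: "cross p q b j = 0"
  have j0: "cross p q i j = 0" if "i \<in> V - {p, q}" for i
    using that b0 tw j unfolding twins_def by (cases "i = b") auto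
  have "cross p q i i' = 0" if "i \<in> V - {p, q}" "i' \<in> V - {p, q}" for i i'
    using j0[OF that(1)] j0[OF that(2)] cross_chain'[of p q i i' j] cross_flip'[of p q j i'] by simp
  then have "twins V p q" using tw unfolding twins_def by auto
  then show False using prime_not_twins[OF V] by blast
qed

lemma cross_at_base: "cross b q j j' = based b q j' - based b q j"
  unfolding cross_def based_def by (simp add: sym[of b])

end

text \<open>
  Here \<open>m\<close> is the length of the cycle.  Two closing equations suffice, because the walks along the
  cycle never use an index above \<open>m + 1\<close>.
\<close>

locale twin_cycle = edge_weights d for d :: "'v \<Rightarrow> 'v \<Rightarrow> 'g::ab_group_add" +
  fixes V :: "'v set" and c :: "nat \<Rightarrow> 'v" and m :: nat
  assumes twin: "twins (V - {c (Suc i)}) (c i) (c (Suc (Suc i)))"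
    and separated: "j \<in> V \<Longrightarrow> j \<noteq> c i \<Longrightarrow> j \<noteq> c (Suc i) \<Longrightarrow> j \<noteq> c (Suc (Suc i)) \<Longrightarrow>
      cross (c i) (c (Suc (Suc i))) (c (Suc i)) j \<noteq> 0"
    and in_V: "c i \<in> V"
    and inj: "inj_on c {..<m}"
    and wrap: "c m = c 0" "c (Suc m) = c 1"
begin

lemma cycle_distinct: "i < m \<Longrightarrow> j < m \<Longrightarrow> i \<noteq> j \<Longrightarrow> c i \<noteq> c j"
  using inj unfolding inj_on_def by blast

lemma twinD:
  assumes "j \<in> V" "j' \<in> V" "j \<notin> {c i, c (Suc i), c (Suc (Suc i))}" "j' \<notin> {c i, c (Suc i), c (Suc (Suc i))}"
  shows "cross (c i) (c (Suc (Suc i))) j j' = 0"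
  using twin[of i] assms unfolding twins_def by auto

text \<open>
  Steps of length two along the cycle preserve the weight towards \<open>v\<close> as long as neither \<open>v\<close> nor
  the base is met, also as an intermediate vertex.
\<close>

lemma chain_aux:
  assumes "v \<in> V" "b \<in> V" "\<And>s. i \<le> s \<Longrightarrow> s \<le> i + 2 * k \<Longrightarrow> c s \<noteq> v \<and> c s \<noteq> b"
  shows "based b (c i) v = based b (c (i + 2 * k)) v"
  using assms(3)
proof (induction k)
  case (Suc k)
  have "cross (c (i + 2 * k)) (c (Suc (Suc (i + 2 * k)))) v b = 0"
    using Suc.prems[of "i + 2 * k"] Suc.prems[of "Suc (i + 2 * k)"] Suc.prems[of "Suc (Suc (i + 2 * k))"]
      assms(1,2) by (intro twinD) auto
  then show ?case using Suc by (simp add: cross_base)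
qed simp

lemma chain:
  assumes "v \<in> V" "b \<in> V" "i \<le> k" "even (k - i)"
    and "\<And>s. i \<le> s \<Longrightarrow> s \<le> k \<Longrightarrow> c s \<noteq> v \<and> c s \<noteq> b"
  shows "based b (c i) v = based b (c k) v"
proof -
  obtain l where "k = i + 2 * l" using assms(3,4) by (metis evenE le_add_diff_inverse)
  then show ?thesis using chain_aux[of v b i l] assms by simp
qed

text \<open>
  Going from \<open>c 2\<close> by steps of two to \<open>c m = c 0\<close>, the weight towards \<open>c 1\<close> cannot change, although
  \<open>c 1\<close> distinguishes \<open>c 0\<close> from \<open>c 2\<close>.
\<close>

lemma even_cycle_proper:
  assumes m: "3 \<le> m" "even m" and b: "b \<in> V" "b \<notin> c ` {..<m}"
  shows False
proof -
  have cb: "c s \<noteq> b" if "s \<le> m" for s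
    using that b m wrap(1) by (cases "s = m") (auto simp: image_iff)
  have "based b (c 2) (c 1) = based b (c m) (c 1)"
  proof (rule chain)
    fix s assume "2 \<le> s" "s \<le> m"
    then show "c s \<noteq> c 1 \<and> c s \<noteq> b"
      using cb cycle_distinct[of s 1] cycle_distinct[of 0 1] wrap(1) m by (cases "s = m") auto
  qed (use m b in_V in auto)
  moreover have "cross (c 0) (c (Suc (Suc 0))) (c (Suc 0)) b \<noteq> 0"
    using separated[of b 0] cb[of 0] cb[of 1] cb[of 2] b m by (auto simp: numeral_2_eq_2)
  ultimately show False using wrap(1) by (simp add: cross_base numeral_2_eq_2)
qed

text \<open>
  For odd \<open>m\<close> the steps of two run through the whole cycle.  The weights of the edges
  \<open>{3, 2}\<close>, \<open>{0, 2}\<close>, \<open>{0, m - 1}\<close>, \<open>{m - 3, m - 1}\<close>, \<open>{m - 3, 1}\<close>, \<open>{2, 1}\<close> agree, moving one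
  end at a time, which contradicts that \<open>c 2\<close> distinguishes \<open>c 1\<close> from \<open>c 3\<close>.  The bound
  \<open>5 \<le> m\<close> keeps \<open>m - 3\<close> away from \<open>0\<close> and \<open>1\<close>.
\<close>

lemma odd_cycle_proper:
  assumes m: "5 \<le> m" "odd m" and b: "b \<in> V" "b \<notin> c ` {..<m}"
  shows False
proof -
  have cb: "c s \<noteq> b" if "s \<le> Suc m" for s
    using that b m wrap
    by (cases "s = m"; cases "s = Suc m") (auto simp: image_iff)
  have "based b (c 3) (c 2) = based b (c m) (c 2)"
  proof (rule chain)
    fix s assume "3 \<le> s" "s \<le> m"
    then show "c s \<noteq> c 2 \<and> c s \<noteq> b"
      using cb cycle_distinct[of s 2] cycle_distinct[of 0 2] wrap m by (cases "s = m") auto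
  qed (use m b in_V in auto)
  moreover have "based b (c 2) (c 0) = based b (c (m - 1)) (c 0)"
  proof (rule chain)
    fix s assume "2 \<le> s" "s \<le> m - 1"
    then show "c s \<noteq> c 0 \<and> c s \<noteq> b" using cb cycle_distinct[of s 0] m by auto
  qed (use m b in_V in auto)
  moreover have "based b (c 0) (c (m - 1)) = based b (c (m - 3)) (c (m - 1))"
  proof (rule chain)
    fix s assume "s \<le> m - 3"
    then show "c s \<noteq> c (m - 1) \<and> c s \<noteq> b" using cb cycle_distinct[of s "m - 1"] m by auto
  qed (use m b in_V in auto)
  moreover have "based b (c (m - 1)) (c (m - 3)) = based b (c (Suc m)) (c (m - 3))"
  proof (rule chain)
    fix s assume "m - 1 \<le> s" "s \<le> Suc m"
    then have "s = m - 1 \<or> s = m \<or> s = Suc m" by arith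
    then have "c s \<in> {c (m - 1), c 0, c 1}" using wrap by auto
    moreover have "m - 3 \<notin> {m - 1, 0, 1}" using m by auto
    ultimately have "c s \<noteq> c (m - 3)"
      using cycle_distinct[of "m - 1" "m - 3"] cycle_distinct[of 0 "m - 3"] cycle_distinct[of 1 "m - 3"] m by auto
    then show "c s \<noteq> c (m - 3) \<and> c s \<noteq> b" using cb \<open>s \<le> Suc m\<close> by blast
  qed (use m b in_V in auto)
  moreover have "based b (c 2) (c 1) = based b (c (m - 3)) (c 1)"
  proof (rule chain)
    fix s assume "2 \<le> s" "s \<le> m - 3"
    then show "c s \<noteq> c 1 \<and> c s \<noteq> b" using cb cycle_distinct[of s 1] m by auto
  qed (use m b in_V in auto)
  moreover have "cross (c 1) (c (Suc (Suc 1))) (c (Suc 1)) b \<noteq> 0"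
    using separated[of b 1] cb[of 1] cb[of 2] cb[of 3] b m by (auto simp: numeral_2_eq_2 numeral_3_eq_3)
  then have "based b (c 1) (c 2) \<noteq> based b (c 3) (c 2)"
    by (simp add: cross_base numeral_2_eq_2 numeral_3_eq_3)
  ultimately show False
    using wrap based_sym[of b "c 0" "c 2"] based_sym[of b "c (m - 1)" "c 0"]
      based_sym[of b "c (m - 3)" "c (m - 1)"] based_sym[of b "c 1" "c (m - 3)"] based_sym[of b "c 1" "c 2"]
    by metis
qed

text \<open>
  When the cycle runs through all vertices, the base has to be one of them.  Taking \<open>c 0\<close>, the twins of
  the base yield constant weights: \<open>c 2\<close> has one weight towards all \<open>c j\<close> with
  \<open>j \<ge> 3\<close>, and \<open>c (m - 2)\<close> towards all \<open>c j\<close> with \<open>1 \<le> j \<le> m - 3\<close>.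
\<close>

lemma even_cycle_full:
  assumes m: "6 \<le> m" "even m"
  shows False
proof -
  have "based (c 0) (c 2) (c 1) = based (c 0) (c (m - 2)) (c 1)"
  proof (rule chain)
    fix s assume "2 \<le> s" "s \<le> m - 2"
    then show "c s \<noteq> c 1 \<and> c s \<noteq> c 0" using cycle_distinct[of s 1] cycle_distinct[of s 0] m by auto
  qed (use m in_V in auto)
  moreover have "cross (c (m - 2)) (c (Suc (Suc (m - 2)))) (c 1) (c 2) = 0"
    using cycle_distinct m wrap(1) in_V by (intro twinD) (auto simp: Suc_diff_Suc numeral_2_eq_2)
  then have "based (c 0) (c (m - 2)) (c 1) = based (c 0) (c (m - 2)) (c 2)"
    using wrap(1) m cross_flip[of "c (m - 2)" "c 0" "c 1" "c 2"]
    by (simp add: Suc_diff_Suc numeral_2_eq_2 cross_at_base)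
  moreover have "cross (c 0) (c (Suc (Suc 0))) (c (Suc 0)) (c (m - 2)) \<noteq> 0"
    by (rule separated) (use cycle_distinct m in_V in auto)
  then have "based (c 0) (c 2) (c 1) \<noteq> based (c 0) (c 2) (c (m - 2))"
    by (simp add: cross_at_base numeral_2_eq_2)
  ultimately show False using based_sym by metis
qed

text \<open>
  Relative to the base \<open>c 0\<close> all weights are determined by the two values \<open>A\<close> of the edge \<open>{2, 1}\<close>
  and \<open>E\<close> of the edge \<open>{2, m - 2}\<close>; the graph is a half graph.  That \<open>c 1\<close> and \<open>c (m - 1)\<close> are twins
  after deleting \<open>c 0\<close> gives \<open>E - A = A - E\<close>.
\<close>

lemma odd_cycle_full:
  assumes m: "7 \<le> m" "odd m"
  shows False
proof -
  let ?e = "\<lambda>i j. based (c 0) (c i) (c j)"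
  have e_sym: "?e i j = ?e j i" for i j by (rule based_sym)
  have S: "Suc (Suc (m - 2)) = m" "Suc (m - 2) = m - 1" "Suc (m - 1) = m" using m by auto
  have "cross (c 0) (c (Suc (Suc 0))) (c (Suc 0)) (c (m - 2)) \<noteq> 0"
    by (rule separated) (use cycle_distinct m in_V in auto)
  then have ne21: "?e 2 1 \<noteq> ?e 2 (m - 2)" by (simp add: cross_at_base numeral_2_eq_2)
  have "cross (c 0) (c (Suc (Suc 0))) (c (m - 1)) (c (m - 2)) = 0"
    by (rule twinD) (use cycle_distinct m in_V in auto)
  then have g1: "?e 2 (m - 1) = ?e 2 (m - 2)" by (simp add: cross_at_base numeral_2_eq_2)
  have g2: "?e 3 1 = ?e (m - 2) 1"
  proof (rule chain)
    fix s assume "3 \<le> s" "s \<le> m - 2"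
    then show "c s \<noteq> c 1 \<and> c s \<noteq> c 0" using cycle_distinct[of s 1] cycle_distinct[of s 0] m by auto
  qed (use m in_V in auto)
  have "cross (c (m - 2)) (c (Suc (Suc (m - 2)))) (c 1) (c 2) = 0"
    by (rule twinD) (use cycle_distinct m wrap(1) in_V S in auto)
  then have g3: "?e (m - 2) 1 = ?e (m - 2) 2"
    using wrap(1) S cross_flip[of "c (m - 2)" "c 0" "c 1" "c 2"] by (simp add: cross_at_base)
  have g4: "?e 1 (m - 1) = ?e 3 (m - 1)"
  proof (rule chain)
    fix s :: nat assume "1 \<le> s" "s \<le> 3"
    then show "c s \<noteq> c (m - 1) \<and> c s \<noteq> c 0" using cycle_distinct[of s "m - 1"] cycle_distinct[of s 0] m by auto
  qed (use m in_V in auto)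
  have g5: "?e 2 1 = ?e (m - 1) 1"
  proof (rule chain)
    fix s assume "2 \<le> s" "s \<le> m - 1"
    then show "c s \<noteq> c 1 \<and> c s \<noteq> c 0" using cycle_distinct[of s 1] cycle_distinct[of s 0] m by auto
  qed (use m in_V in auto)
  have "cross (c (m - 1)) (c (Suc (Suc (m - 1)))) (c 2) (c 3) = 0"
    by (rule twinD) (use cycle_distinct m wrap in_V S in auto)
  then have "cross (c (m - 1)) (c 1) (c 2) (c 3) = 0" using S wrap by simp
  then have "?e (m - 1) 2 - ?e 1 2 - ?e (m - 1) 3 + ?e 1 3 = 0"
    unfolding cross_based[where b = "c 0"] .
  moreover have "?e (m - 1) 2 = ?e 2 (m - 2)" using g1 e_sym[of "m - 1" 2] by simp
  moreover have "?e 1 2 = ?e 2 1" by (rule e_sym)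
  moreover have "?e (m - 1) 3 = ?e 2 1"
    using g4 g5 e_sym[of "m - 1" 3] e_sym[of "m - 1" 1] by simp
  moreover have "?e 1 3 = ?e 2 (m - 2)"
    using g2 g3 e_sym[of 1 3] e_sym[of "m - 2" 2] by simp
  ultimately have "?e 2 (m - 2) - ?e 2 1 - ?e 2 1 + ?e 2 (m - 2) = 0" by (simp only:)
  then have "(?e 2 (m - 2) - ?e 2 1) + (?e 2 (m - 2) - ?e 2 1) = 0"
    by (simp only: add_diff_eq diff_add_eq)
  then have "?e 2 (m - 2) - ?e 2 1 = 0" by (rule no_2_torsion)
  then show False using ne21 by simp
qed

text \<open>
  The three vertices of the cycle are pairwise twins towards the rest, hence form a part of a split.
\<close>

lemma three_cycle:
  assumes m: "m = 3" and V: "prime_set V" "6 \<le> card V"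
  shows False
proof -
  let ?C = "c ` {..<m}"
  have C: "?C = {c 0, c 1, c 2}" unfolding m by (auto simp: lessThan_Suc numeral_3_eq_3 numeral_2_eq_2)
  have card: "card ?C = 3" using inj m by (simp add: card_image)
  have 1: "cross (c 0) (c 2) j j' = 0" if "j \<in> V - ?C" "j' \<in> V - ?C" for j j'
    using twinD[of j j' 0] that C by (auto simp: numeral_2_eq_2)
  have 2: "cross (c 1) (c 0) j j' = 0" if "j \<in> V - ?C" "j' \<in> V - ?C" for j j'
    using twinD[of j j' 1] that C wrap(1) m by (auto simp: numeral_2_eq_2 numeral_3_eq_3)
  have z: "cross i (c 0) j j' = 0" if "i \<in> ?C" "j \<in> V - ?C" "j' \<in> V - ?C" for i j j'
    using that(1) 1[OF that(2,3)] 2[OF that(2,3)] cross_flip[of "c 2" "c 0" j j'] unfolding C by auto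
  have "cross i i' j j' = 0" if "i \<in> ?C" "i' \<in> ?C" "j \<in> V - ?C" "j' \<in> V - ?C" for i i' j j'
    using z[OF that(1,3,4)] z[OF that(2-4)] cross_chain[of i i' j j' "c 0"] cross_flip[of "c 0" i' j j']
    by simp
  moreover have "?C \<subseteq> V" using in_V by auto
  moreover have "card (V - ?C) = card V - 3" using card \<open>?C \<subseteq> V\<close> by (simp add: card_Diff_subset)
  ultimately have "split V ?C" using V card unfolding split_def by auto
  then show False using V unfolding prime_set_def by blast
qed

lemma no_twin_cycle:
  assumes m: "3 \<le> m" and V: "prime_set V" "6 \<le> card V"
  shows False
proof (cases "V \<subseteq> c ` {..<m}")
  case True
  then have "V = c ` {..<m}" using in_V by auto
  then have m6: "6 \<le> m" using card_image[OF inj] V(2) by simp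
  show False
  proof (cases "even m")
    case True
    then show False using even_cycle_full m6 by blast
  next
    case False
    then have "7 \<le> m" using m6 by presburger
    then show False using odd_cycle_full False by blast
  qed
next
  case False
  then obtain b where b: "b \<in> V" "b \<notin> c ` {..<m}" by blast
  have "m = 3 \<or> even m \<or> (5 \<le> m \<and> odd m)" using m by presburger
  then show False
    using even_cycle_proper[OF m _ b] odd_cycle_proper[OF _ _ b] three_cycle[OF _ V] by blast
qed

end

context edge_weights
begin

text \<open>
  Repeatedly passing from \<open>(a, b)\<close> to \<open>(b, a')\<close> yields a sequence, which returns to earlier vertices
  because \<open>V\<close> is finite.  As a vertex has only two linked vertices, the first vertex to occur twice
  is \<open>c 0\<close>, and the sequence continues with \<open>c 1\<close>.
\<close>

lemma no_linked_pair:
  assumes V: "prime_set V" "6 \<le> card V"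
    and crit: "\<And>k. k \<in> V \<Longrightarrow> \<not> prime_set (V - {k})"
  shows "\<not> linked V x y"
proof
  assume xy: "linked V x y"
  have "\<exists>f. \<forall>i. linked V (fst (f i)) (snd (f i)) \<and>
    (fst (f (Suc i)) = snd (f i) \<and> twins (V - {snd (f i)}) (fst (f i)) (snd (f (Suc i))))"
  proof (rule dependent_nat_choice)
    show "\<exists>p. linked V (fst p) (snd p)" using xy by (intro exI[of _ "(x, y)"]) simp
    fix p :: "'v \<times> 'v" and i :: nat assume "linked V (fst p) (snd p)"
    from linked_step[OF crit this]
    show "\<exists>q. linked V (fst q) (snd q) \<and>
        (fst q = snd p \<and> twins (V - {snd p}) (fst p) (snd q))"
      by (metis fst_conv snd_conv)
  qed
  then obtain f where f: "\<And>i. linked V (fst (f i)) (snd (f i))"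
    and st: "\<And>i. fst (f (Suc i)) = snd (f i) \<and> twins (V - {snd (f i)}) (fst (f i)) (snd (f (Suc i)))"
    by blast
  define c where "c i = fst (f i)" for i
  have lk: "linked V (c i) (c (Suc i))" for i using f[of i] st[of i] unfolding c_def by simp
  have tw: "twins (V - {c (Suc i)}) (c i) (c (Suc (Suc i)))" for i
    using st[of i] st[of "Suc i"] unfolding c_def by simp
  have lk': "linked V (c (Suc i)) (c i)" for i
    using lk[of i] unfolding linked_def by (auto simp: insert_commute)
  have inV: "c i \<in> V" for i using lk[of i] unfolding linked_def by blast
  have nb: "c i \<noteq> c (Suc i)" "c i \<noteq> c (Suc (Suc i))" for i
    using lk[of i] tw[of i] unfolding linked_def twins_def by auto
  have "finite V" using V unfolding prime_set_def by blast
  have "\<exists>m. c m \<in> c ` {..<m}"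
  proof (rule ccontr)
    assume no: "\<nexists>m. c m \<in> c ` {..<m}"
    have "inj c"
    proof (rule injI)
      fix i j assume "c i = c j"
      then show "i = j" using no by (metis image_eqI lessThan_iff linorder_neqE_nat)
    qed
    then have "infinite (range c)" using finite_imageD by blast
    then show False using \<open>finite V\<close> inV by (meson finite_subset image_subsetI)
  qed
  define m where "m = (LEAST m. c m \<in> c ` {..<m})"
  have m1: "c m \<in> c ` {..<m}" unfolding m_def by (rule LeastI_ex) fact
  have mleast: "c k \<notin> c ` {..<k}" if "k < m" for k using not_less_Least that unfolding m_def by blast
  have inj: "inj_on c {..<m}"
  proof (rule inj_onI)
    fix i j assume "i \<in> {..<m}" "j \<in> {..<m}" "c i = c j"
    then show "i = j" using mleast[of i] mleast[of j]
      by (metis image_eqI lessThan_iff linorder_neqE_nat)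
  qed
  obtain l where l: "l < m" "c m = c l" using m1 by auto
  have m3: "3 \<le> m"
  proof (rule ccontr)
    assume "\<not> 3 \<le> m"
    then have "(m = 1 \<and> l = 0) \<or> (m = 2 \<and> (l = 0 \<or> l = 1))" using l by auto
    then show False using l nb[of 0] nb[of 1] by (auto simp: numeral_2_eq_2)
  qed
  obtain k where k: "m = Suc k" "2 \<le> k" using m3 by (metis Suc_le_D Suc_le_mono numeral_2_eq_2 numeral_3_eq_3)
  have "l = 0"
  proof (rule ccontr)
    assume "l \<noteq> 0"
    then obtain l' where l': "l = Suc l'" by (cases l) auto
    have "c k = c l' \<or> c k = c (Suc l)"
      using linked_in_twins[of V "c k" "c l"] lk[of k] tw[of l'] l k l' by auto
    moreover have "c k \<noteq> c l'" using inj k l l' unfolding inj_on_def by force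
    moreover have "c k \<noteq> c (Suc l)"
    proof
      assume e: "c k = c (Suc l)"
      then have "Suc l \<noteq> m" using nb(1)[of k] k l by auto
      then have "k = Suc l" using inj k l e unfolding inj_on_def by force
      then show False using nb(2)[of l] l k by simp
    qed
    ultimately show False by blast
  qed
  then have w0: "c m = c 0" using l by simp
  have "c 1 = c k \<or> c 1 = c (Suc m)"
    using linked_in_twins[of V "c 1" "c 0" "c k" "c (Suc m)"] lk'[of 0] tw[of k] k w0 by simp
  moreover have "c 1 \<noteq> c k" using inj k unfolding inj_on_def by force
  ultimately have w1: "c (Suc m) = c 1" by simp
  interpret twin_cycle d V c m
  proof
    fix i j assume "j \<in> V" "j \<noteq> c i" "j \<noteq> c (Suc i)" "j \<noteq> c (Suc (Suc i))"
    then show "cross (c i) (c (Suc (Suc i))) (c (Suc i)) j \<noteq> 0"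
      using twins_separated[OF V(1) tw, of i j] inV by auto
  qed (use tw inV inj w0 w1 in auto)
  show False using no_twin_cycle[OF m3 V] .
qed

text \<open>
  A maximal prime proper subset \<open>X\<close> of \<open>V\<close> misses one or two vertices, because the next set
  provided by \<open>prime_step_up\<close> has to be \<open>V\<close>; missing two of them is excluded by \<open>no_linked_pair\<close>.
\<close>

theorem prime_set_removable:
  assumes V: "prime_set V" and card: "5 \<le> card V"
  obtains k where "k \<in> V" "prime_set (V - {k})"
proof (rule ccontr)
  assume "\<not> thesis"
  then have crit: "\<And>k. k \<in> V \<Longrightarrow> \<not> prime_set (V - {k})" using that by blast
  have fin: "finite V" using V unfolding prime_set_def by blast
  obtain X0 where X0: "X0 \<subseteq> V" "card X0 = 4" "prime_set X0" using prime_contains_four[OF V] by blast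
  define P where "P X \<longleftrightarrow> X \<subset> V \<and> prime_set X" for X
  have "P X0" using X0 card unfolding P_def by auto
  moreover have "\<forall>X. P X \<longrightarrow> card X < Suc (card V)" 
    using fin card_mono unfolding P_def by (auto simp: less_Suc_eq_le)
  ultimately have "\<exists>X. P X \<and> (\<forall>Y. P Y \<longrightarrow> card Y \<le> card X)" by (rule ex_has_greatest_nat)
  then obtain X where X: "P X" and max: "\<And>Y. P Y \<Longrightarrow> card Y \<le> card X" by blast
  obtain Y where Y: "prime_set Y" "X \<subset> Y" "Y \<subseteq> V" "card Y \<le> card X + 2"
    using prime_step_up[OF V, of X] X unfolding P_def by blast
  have finY: "finite Y" using Y(1) unfolding prime_set_def by blast
  have "card X < card Y" using Y(2) finY by (rule psubset_card_mono[rotated])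
  then have "Y = V" using max[of Y] Y unfolding P_def by fastforce
  moreover have "card (Y - X) = card Y - card X" using Y(2) finY
    by (meson card_Diff_subset finite_subset psubsetE)
  ultimately have "card (V - X) = 1 \<or> card (V - X) = 2" using Y(4) \<open>card X < card Y\<close> by auto
  then show False
  proof
    assume "card (V - X) = 1"
    then obtain k where "V - X = {k}" using card_1_singletonE by blast
    then have "k \<in> V" "V - {k} = X" using X unfolding P_def by auto
    then show False using crit X unfolding P_def by auto
  next
    assume 2: "card (V - X) = 2"
    then obtain x y where xy: "V - X = {x, y}" "x \<noteq> y" by (meson card_2_iff)
    then have "V - {x, y} = X" using X unfolding P_def by auto
    then have "linked V x y" using X xy unfolding linked_def P_def by auto
    moreover have "6 \<le> card V"
      using X \<open>Y = V\<close> 2 \<open>card (Y - X) = card Y - card X\<close> unfolding P_def prime_set_def by auto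
    ultimately show False using no_linked_pair[OF V _ crit] by blast
  qed
qed

end

section \<open>Quadratic functions in coordinates\<close>

text \<open>
  The matrix \<open>m\<close> need not be symmetric or triangular, so it is not determined by \<open>f\<close>.
\<close>

definition quadratic_coeffs ::
  "nat \<Rightarrow> ('a::comm_ring_1 list \<Rightarrow> 'a) \<Rightarrow> 'a \<Rightarrow> (nat \<Rightarrow> 'a) \<Rightarrow> (nat \<Rightarrow> nat \<Rightarrow> 'a) \<Rightarrow> bool" where
  "quadratic_coeffs n f c l m \<longleftrightarrow> (\<forall>xs. length xs = n \<longrightarrow>
     f xs = c + (\<Sum>i<n. l i * xs ! i) + (\<Sum>i<n. \<Sum>j<n. m i j * (xs ! i * xs ! j)))"

lemma quadratic_coeffs_cong:
  "(\<And>xs. length xs = n \<Longrightarrow> f xs = g xs) \<Longrightarrow> quadratic_coeffs n g c l m \<Longrightarrow> quadratic_coeffs n f c l m"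
  unfolding quadratic_coeffs_def by simp

lemma quadratic_coeffs_const: "quadratic_coeffs n (\<lambda>_. c) c (\<lambda>_. 0) (\<lambda>_ _. 0)"
  unfolding quadratic_coeffs_def by simp

lemma quadratic_coeffs_linear:
  assumes "k < n"
  shows "quadratic_coeffs n (\<lambda>xs. c * xs ! k) 0 (\<lambda>i. if i = k then c else 0) (\<lambda>_ _. 0)"
  using assms unfolding quadratic_coeffs_def by (simp add: if_distrib[of "\<lambda>t. t * _"] cong: if_cong)

lemma quadratic_coeffs_product:
  assumes "k < n" "k' < n"
  shows "quadratic_coeffs n (\<lambda>xs. c * (xs ! k * xs ! k')) 0 (\<lambda>_. 0)
    (\<lambda>i j. if i = k then if j = k' then c else 0 else 0)"
  unfolding quadratic_coeffs_def
proof (intro allI impI)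
  fix xs :: "'a list" assume "length xs = n"
  have "(\<Sum>i<n. \<Sum>j<n. (if i = k then if j = k' then c else 0 else 0) * (xs ! i * xs ! j)) =
      (\<Sum>i<n. if i = k then (\<Sum>j<n. if j = k' then c * (xs ! i * xs ! j) else 0) else 0)"
    by (intro sum.cong refl) (auto intro!: sum.cong simp: if_distrib[of "\<lambda>t. t * _"] cong: if_cong)
  also have "\<dots> = c * (xs ! k * xs ! k')" using assms by (simp add: sum.delta)
  finally show "c * (xs ! k * xs ! k') = 0 + (\<Sum>i<n. 0 * xs ! i) +
      (\<Sum>i<n. \<Sum>j<n. (if i = k then if j = k' then c else 0 else 0) * (xs ! i * xs ! j))"
    by simp
qed

lemma quadratic_coeffs_add:
  assumes "quadratic_coeffs n f c l m" "quadratic_coeffs n g c' l' m'"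
  shows "quadratic_coeffs n (\<lambda>xs. f xs + g xs) (c + c') (\<lambda>i. l i + l' i) (\<lambda>i j. m i j + m' i j)"
  using assms unfolding quadratic_coeffs_def by (simp add: distrib_right sum.distrib)

lemma quadratic_coeffs_sum:
  assumes "finite S" "\<And>t. t \<in> S \<Longrightarrow> \<exists>c l m. quadratic_coeffs n (f t) c l m"
  shows "\<exists>c l m. quadratic_coeffs n (\<lambda>xs. \<Sum>t\<in>S. f t xs) c l m"
  using assms
proof (induction S rule: finite_induct)
  case empty
  then show ?case using quadratic_coeffs_const[of n 0] by auto
next
  case (insert t S)
  have "\<exists>c l m. quadratic_coeffs n (f t) c l m"
    "\<exists>c l m. quadratic_coeffs n (\<lambda>xs. \<Sum>t\<in>S. f t xs) c l m"
    using insert by auto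
  then obtain c l m c' l' m' where
    "quadratic_coeffs n (f t) c l m" "quadratic_coeffs n (\<lambda>xs. \<Sum>t\<in>S. f t xs) c' l' m'"
    by metis
  from quadratic_coeffs_add[OF this] show ?case using insert.hyps by auto
qed

lemma quadratic_coeffs_monomial:
  fixes c :: "'a::comm_ring_1" and e :: "nat \<Rightarrow>\<^sub>0 nat"
  assumes K: "Poly_Mapping.keys e \<subseteq> {..<n}"
    and deg: "(\<Sum>i\<in>Poly_Mapping.keys e. Poly_Mapping.lookup e i) \<le> 2"
  shows "\<exists>c' l m. quadratic_coeffs n
    (\<lambda>xs. c * (\<Prod>i\<in>Poly_Mapping.keys e. (xs ! i) ^ Poly_Mapping.lookup e i)) c' l m"
proof -
  let ?K = "Poly_Mapping.keys e" and ?e = "Poly_Mapping.lookup e"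
  have fin: "finite ?K" by simp
  have pos: "?e i \<ge> 1" if "i \<in> ?K" for i using that by (simp add: in_keys_iff Suc_le_eq)
  have "card ?K \<le> (\<Sum>i\<in>?K. ?e i)" using sum_mono[of ?K "\<lambda>_. 1" ?e] pos by simp
  then have "card ?K = 0 \<or> card ?K = 1 \<or> card ?K = 2" using deg by linarith
  then consider "?K = {}" | i where "?K = {i}" | i j where "?K = {i, j}" "i \<noteq> j"
    using fin by (metis card_0_eq card_1_singletonE card_2_iff)
  then show ?thesis
  proof cases
    case 1
    show ?thesis unfolding 1 using quadratic_coeffs_const[of n c] by auto
  next
    case (2 i)
    then have i: "i < n" using K by auto
    have "?e i = 1 \<or> ?e i = 2" using deg pos[of i] 2 by auto
    then show ?thesis
    proof
      assume "?e i = 1"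
      then show ?thesis unfolding 2 using quadratic_coeffs_linear[OF i, of c] by auto
    next
      assume "?e i = 2"
      then show ?thesis unfolding 2 using quadratic_coeffs_product[OF i i, of c]
        by (auto simp: power2_eq_square)
    qed
  next
    case (3 i j)
    then have ij: "i < n" "j < n" using K by auto
    have "?e i + ?e j \<le> 2" using deg 3 by simp
    then have "?e i = 1" "?e j = 1" using pos[of i] pos[of j] 3(1) by auto
    then show ?thesis unfolding 3(1) using 3(2) quadratic_coeffs_product[OF ij, of c] by auto
  qed
qed

lemma quadratic_has_coeffs:
  fixes f :: "'a::comm_ring_1 list \<Rightarrow> 'a"
  assumes "quadratic n f"
  obtains c l m where "quadratic_coeffs n f c l m"
proof -
  obtain p :: "'a multi_poly" where
    p: "\<forall>e\<in>Poly_Mapping.keys p. Poly_Mapping.keys e \<subseteq> {..<n} \<and>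
           (\<Sum>i\<in>Poly_Mapping.keys e. Poly_Mapping.lookup e i) \<le> 2"
    and f: "\<forall>xs. length xs = n \<longrightarrow> f xs = eval_multi_poly p xs"
    using assms unfolding quadratic_def by blast
  have "\<exists>c l m. quadratic_coeffs n (eval_multi_poly p) c l m"
    unfolding eval_multi_poly_def[abs_def]
    by (rule quadratic_coeffs_sum, simp) (rule quadratic_coeffs_monomial; use p in blast)
  then show thesis using that quadratic_coeffs_cong[of n f "eval_multi_poly p"] f by blast
qed

definition vec :: "nat \<Rightarrow> (nat \<Rightarrow> 'a) \<Rightarrow> 'a list" where
  "vec n \<phi> = map \<phi> [0..<n]"

lemma length_vec [simp]: "length (vec n \<phi>) = n"
  and nth_vec [simp]: "i < n \<Longrightarrow> vec n \<phi> ! i = \<phi> i"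
  unfolding vec_def by simp_all

definition pair_coeff :: "nat \<Rightarrow> (nat \<Rightarrow> nat \<Rightarrow> 'a::comm_ring_1) \<Rightarrow> nat \<Rightarrow> nat \<Rightarrow> 'a" where
  "pair_coeff n m i j = (if i < n \<and> j < n then m i j + m j i else 0)"

lemma sum_unit:
  fixes g :: "nat \<Rightarrow> 'a::comm_ring_1"
  assumes "k < n"
  shows "(\<Sum>t<n. of_bool (t = k)) = (1::'a)"
    and "(\<Sum>t<n. of_bool (t = k) * g t) = g k"
    and "(\<Sum>t<n. g t * of_bool (t = k)) = g k"
  using assms unfolding of_bool_def by (simp_all add: if_distrib[of "\<lambda>t. t * _"] if_distrib[of "\<lambda>t. _ * t"] cong: if_cong)

text \<open>
  The polarization identity of a quadratic function with linear terms.
\<close>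

lemma quadratic_vec_add:
  fixes \<phi> \<psi> :: "nat \<Rightarrow> 'a::comm_ring_1"
  assumes f: "quadratic_coeffs n f c l m"
  shows "f (vec n (\<lambda>i. \<phi> i + \<psi> i)) =
    f (vec n \<phi>) + f (vec n \<psi>) - c + (\<Sum>i<n. \<Sum>j<n. pair_coeff n m i j * (\<phi> i * \<psi> j))"
proof -
  have F: "f (vec n \<theta>) = c + (\<Sum>i<n. l i * \<theta> i) + (\<Sum>i<n. \<Sum>j<n. m i j * (\<theta> i * \<theta> j))" for \<theta>
    using f unfolding quadratic_coeffs_def by simp
  have "(\<Sum>i<n. \<Sum>j<n. pair_coeff n m i j * (\<phi> i * \<psi> j)) =
      (\<Sum>i<n. \<Sum>j<n. m i j * (\<phi> i * \<psi> j)) + (\<Sum>i<n. \<Sum>j<n. m j i * (\<phi> i * \<psi> j))"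
    unfolding pair_coeff_def by (simp add: distrib_right sum.distrib)
  also have "(\<Sum>i<n. \<Sum>j<n. m j i * (\<phi> i * \<psi> j)) = (\<Sum>i<n. \<Sum>j<n. m i j * (\<psi> i * \<phi> j))"
    by (subst sum.swap) (simp add: mult.commute)
  finally show ?thesis
    unfolding F by (simp add: algebra_simps sum.distrib)
qed

section \<open>Tuples indexed by a set of coordinates\<close>

lemma nths_eq_imp_nth_eq:
  "length xs = length ys \<Longrightarrow> nths xs W = nths ys W \<Longrightarrow> i \<in> W \<Longrightarrow> i < length xs \<Longrightarrow> xs ! i = ys ! i"
proof (induction xs ys arbitrary: W i rule: list_induct2)
  case (Cons x xs y ys)
  show ?case
  proof (cases i)
    case 0
    then show ?thesis using Cons.prems by (simp add: nths_Cons)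
  next
    case (Suc k)
    have "nths xs {j. Suc j \<in> W} = nths ys {j. Suc j \<in> W}"
      using Cons.prems(1) by (auto simp: nths_Cons split: if_splits)
    then show ?thesis using Cons.IH[of "{j. Suc j \<in> W}" k] Cons.prems Suc by simp
  qed
qed simp

lemma nths_cong:
  "length xs = length ys \<Longrightarrow> (\<And>i. i < length xs \<Longrightarrow> i \<in> W \<Longrightarrow> xs ! i = ys ! i) \<Longrightarrow> nths xs W = nths ys W"
proof (induction xs ys arbitrary: W rule: list_induct2)
  case (Cons x xs y ys)
  have "nths xs {j. Suc j \<in> W} = nths ys {j. Suc j \<in> W}"
    by (rule Cons.IH) (use Cons.prems[of "Suc _"] in auto)
  then show ?case using Cons.prems[of 0] by (auto simp: nths_Cons)
qed simp

lemma sum_list_nths: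
  fixes xs :: "'a::comm_monoid_add list"
  shows "sum_list (nths xs W) = (\<Sum>i<length xs. if i \<in> W then xs ! i else 0)"
proof (induction xs arbitrary: W)
  case (Cons x xs)
  have "(\<Sum>i<length (x # xs). if i \<in> W then (x # xs) ! i else 0) =
      (if 0 \<in> W then x else 0) + (\<Sum>i<length xs. if Suc i \<in> W then xs ! i else 0)"
    unfolding length_Cons sum.lessThan_Suc_shift by (simp cong: if_cong)
  then show ?case using Cons.IH[of "{j. Suc j \<in> W}"] by (simp add: nths_Cons)
qed simp

lemma sum_list_vec: "sum_list (vec n \<phi>) = (\<Sum>i<n. \<phi> i)"
  unfolding vec_def by (simp add: interv_sum_list_conv_sum_set_nat atLeast0LessThan)

lemma sum_list_nths_compl:
  fixes xs :: "'a::comm_monoid_add list"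
  shows "sum_list (nths xs (- W)) + sum_list (nths xs W) = sum_list xs"
proof (induction xs arbitrary: W)
  case (Cons x xs)
  have "{j. Suc j \<in> - W} = - {j. Suc j \<in> W}" by auto
  then show ?case using Cons.IH[of "{j. Suc j \<in> W}"] by (auto simp: nths_Cons ac_simps)
qed simp

text \<open>
  This replaces an explicit inverse of \<open>nths\<close>: a function that depends on the coordinates in \<open>W\<close>
  is a function of the subtuple.
\<close>

lemma nths_factor:
  assumes "\<And>xs ys. length xs = n \<Longrightarrow> length ys = n \<Longrightarrow> (\<forall>i<n. i \<in> W \<longrightarrow> xs ! i = ys ! i) \<Longrightarrow> F xs = F ys"
  obtains h where "\<And>xs. length xs = n \<Longrightarrow> F xs = h (nths xs W)"
proof
  fix xs :: "'a list" assume n: "length xs = n"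
  let ?P = "\<lambda>zs. length zs = n \<and> nths zs W = nths xs W"
  have "?P (SOME zs. ?P zs)" by (rule someI[of ?P xs]) (use n in simp)
  then show "F xs = F (SOME zs. ?P zs)"
    using n nths_eq_imp_nth_eq[of xs "SOME zs. ?P zs" W] by (intro assms) auto
qed

section \<open>Separability of the quasigroups\<close>

text \<open>
  The outer quasigroup is injective in its last argument, so the equality of two values at tuples
  that differ only in \<open>W\<close> means that the inner quasigroup has equal values, and this persists for
  other values of the variables outside \<open>W\<close>.
\<close>

lemma W_separable_exchange:
  assumes sep: "W_separable n W Q" and Wn: "W \<subseteq> {..<n}"
    and len: "length zs = n" "length zs' = n" "length ws = n" "length ws' = n"
    and W: "\<And>k. k < n \<Longrightarrow> k \<in> W \<Longrightarrow> zs ! k = ws ! k \<and> zs' ! k = ws' ! k"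
    and W': "\<And>k. k < n \<Longrightarrow> k \<notin> W \<Longrightarrow> zs ! k = zs' ! k \<and> ws ! k = ws' ! k"
    and eq: "Q zs = Q zs'"
  shows "Q ws = Q ws'"
proof -
  obtain G H where G: "nary_quasigroup (n - card W + 1) G"
    and Q: "\<And>xs. length xs = n \<Longrightarrow> Q xs = G (nths xs (- W) @ [H (nths xs W)])"
    using sep unfolding W_separable_def by blast
  have nW: "nths zs W = nths ws W" "nths zs' W = nths ws' W"
    and nW': "nths zs (- W) = nths zs' (- W)" "nths ws (- W) = nths ws' (- W)"
    by (rule nths_cong; use len W W' in simp)+
  have G_inj: "u = v" if "length p = n - card W" "G (p @ [u]) = G (p @ [v])" for p u v
  proof -
    have upd: "(p @ [u])[n - card W := w] = p @ [w]" for w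
      using that(1) by (simp flip: that(1))
    have "\<exists>!w. G (p @ [u]) = G ((p @ [u])[n - card W := w])"
      using G that(1) unfolding nary_quasigroup_def by auto
    then have "\<exists>!w. G (p @ [u]) = G (p @ [w])" unfolding upd .
    then show "u = v" using that(2) by blast
  qed
  have "{i. i < n \<and> i \<in> - W} = {..<n} - W" by auto
  then have "length (nths zs (- W)) = n - card W"
    using Wn len(1) by (simp add: length_nths card_Diff_subset finite_subset)
  then have "H (nths zs W) = H (nths zs' W)" by (rule G_inj) (use eq Q len nW' in simp)
  then show ?thesis using Q len nW nW' by simp
qed

lemma nary_quasigroup_minus_Q_op:
  "nary_quasigroup n (\<lambda>zs. (- fst (Q_op h a zs), - snd (Q_op h a zs)))"
  unfolding nary_quasigroup_def
proof (intro allI impI)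
  fix xs :: "('a::comm_ring \<times> 'a) list" and x0 :: "'a \<times> 'a" and i
  assume "length xs = n \<and> i < n"
  then have "\<exists>!v. (- fst x0, - snd x0) = Q_op h a (xs[i := v])"
    using nary_quasigroup_Q_op[of n h a] unfolding nary_quasigroup_def by blast
  moreover have "((- fst x0, - snd x0) = y) = (x0 = (- fst y, - snd y))" for y :: "'a \<times> 'a"
    by (auto simp: prod_eq_iff) (metis minus_minus)+
  ultimately show "\<exists>!v. x0 = (- fst (Q_op h a (xs[i := v])), - snd (Q_op h a (xs[i := v])))"
    by simp
qed

text \<open>
  The mixed part of \<open>f\<close> is a linear form in the outer variables times the sum of the variables
  in \<open>W\<close>.
\<close>

lemma quadratic_cut:
  assumes f: "quadratic_coeffs n f c l m" and W: "W \<subseteq> {..<n}"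
    and \<alpha>: "\<And>i j. i < n \<Longrightarrow> i \<notin> W \<Longrightarrow> j \<in> W \<Longrightarrow> pair_coeff n m i j = \<alpha> i"
    and len: "length xs = n"
  shows "f xs = f (vec n (\<lambda>i. if i \<in> W then xs ! i else 0)) +
      (f (vec n (\<lambda>i. if i \<in> W then 0 else xs ! i)) - c) +
      (\<Sum>i<n. if i \<in> W then 0 else \<alpha> i * xs ! i) * sum_list (nths xs W)"
proof -
  let ?p = "\<lambda>i. if i \<in> W then xs ! i else 0" and ?r = "\<lambda>i. if i \<in> W then 0 else xs ! i"
  have "xs = vec n (\<lambda>i. ?r i + ?p i)" using len by (intro nth_equalityI) auto
  then have "f xs = f (vec n ?r) + f (vec n ?p) - c +
      (\<Sum>i<n. \<Sum>j<n. pair_coeff n m i j * (?r i * ?p j))"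
    using quadratic_vec_add[OF f, of ?r ?p] by simp
  also have "(\<Sum>i<n. \<Sum>j<n. pair_coeff n m i j * (?r i * ?p j)) =
      (\<Sum>i<n. \<Sum>j<n. (if i \<in> W then 0 else \<alpha> i * xs ! i) * ?p j)"
    using \<alpha> by (intro sum.cong refl) auto
  also have "\<dots> = (\<Sum>i<n. if i \<in> W then 0 else \<alpha> i * xs ! i) * sum_list (nths xs W)"
    unfolding sum_list_nths len sum_product ..
  finally show ?thesis by simp
qed

text \<open>
  The inner quasigroup passes on the sum of the variables in \<open>W\<close>, and collects the part of \<open>f\<close> that lives
  on \<open>W\<close> in the second component.  Its sign is opposite to that of \<open>Q_op\<close>, because the outer
  operation negates its arguments once more.
\<close>

lemma W_separable_Q_op:
  assumes f: "quadratic_coeffs n f c l m" and W: "W \<subseteq> {..<n}"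
    and \<alpha>: "\<And>i j. i < n \<Longrightarrow> i \<notin> W \<Longrightarrow> j \<in> W \<Longrightarrow> pair_coeff n m i j = \<alpha> i"
  shows "W_separable n W (Q_op f a)"
proof -
  obtain h where h: "\<And>xs. length xs = n \<Longrightarrow>
      f (vec n (\<lambda>i. if i \<in> W then xs ! i else 0)) = h (nths xs W)"
  proof (rule nths_factor[where F = "\<lambda>xs. f (vec n (\<lambda>i. if i \<in> W then xs ! i else 0))" and n = n and W = W])
    fix xs ys :: "'a list" assume "\<forall>i<n. i \<in> W \<longrightarrow> xs ! i = ys ! i"
    then have "vec n (\<lambda>i. if i \<in> W then xs ! i else 0) = vec n (\<lambda>i. if i \<in> W then ys ! i else 0)"
      by (auto simp: vec_def)
    then show "f (vec n (\<lambda>i. if i \<in> W then xs ! i else 0)) = f (vec n (\<lambda>i. if i \<in> W then ys ! i else 0))"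
      by simp
  qed blast
  obtain g where g: "\<And>xs. length xs = n \<Longrightarrow>
      f (vec n (\<lambda>i. if i \<in> W then 0 else xs ! i)) - c = g (nths xs (- W))"
  proof (rule nths_factor[where F = "\<lambda>xs. f (vec n (\<lambda>i. if i \<in> W then 0 else xs ! i)) - c" and n = n and W = "- W"])
    fix xs ys :: "'a list" assume "\<forall>i<n. i \<in> - W \<longrightarrow> xs ! i = ys ! i"
    then have "vec n (\<lambda>i. if i \<in> W then 0 else xs ! i) = vec n (\<lambda>i. if i \<in> W then 0 else ys ! i)"
      by (auto simp: vec_def)
    then show "f (vec n (\<lambda>i. if i \<in> W then 0 else xs ! i)) - c = f (vec n (\<lambda>i. if i \<in> W then 0 else ys ! i)) - c"
      by simp
  qed blast
  obtain s where s: "\<And>xs. length xs = n \<Longrightarrow>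
      (\<Sum>i<n. if i \<in> W then 0 else \<alpha> i * xs ! i) = s (nths xs (- W))"
  proof (rule nths_factor[where F = "\<lambda>xs. \<Sum>i<n. if i \<in> W then 0 else \<alpha> i * xs ! i" and n = n and W = "- W"])
    fix xs ys :: "'a list" assume "\<forall>i<n. i \<in> - W \<longrightarrow> xs ! i = ys ! i"
    then show "(\<Sum>i<n. if i \<in> W then 0 else \<alpha> i * xs ! i) = (\<Sum>i<n. if i \<in> W then 0 else \<alpha> i * ys ! i)"
      by (intro sum.cong) auto
  qed blast
  define H where "H zs = (- fst (Q_op h 0 zs), - snd (Q_op h 0 zs))" for zs
  define G where "G = Q_op (\<lambda>zs. g (butlast zs) + s (butlast zs) * last zs) a"
  have "Q_op f a zs = G (nths zs (- W) @ [H (nths zs W)])" if len: "length zs = n" for zs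
  proof -
    let ?X = "map fst zs" and ?Y = "map snd zs"
    have H: "H (nths zs W) = (sum_list (nths ?X W), sum_list (nths ?Y W) - h (nths ?X W))"
      unfolding H_def Q_op_def by (simp add: nths_map)
    have "f ?X = h (nths ?X W) + (g (nths ?X (- W)) + s (nths ?X (- W)) * sum_list (nths ?X W))"
      using quadratic_cut[OF f W \<alpha>, of ?X] h[of ?X] g[of ?X] s[of ?X] len by simp
    moreover have "sum_list ?X = sum_list (nths ?X (- W)) + sum_list (nths ?X W)"
      "sum_list ?Y = sum_list (nths ?Y (- W)) + sum_list (nths ?Y W)"
      by (simp_all add: sum_list_nths_compl)
    ultimately show ?thesis
      unfolding G_def H by (simp add: Q_op_def nths_map)
  qed
  moreover have "nary_quasigroup (card W) H" unfolding H_def by (rule nary_quasigroup_minus_Q_op)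
  moreover have "nary_quasigroup (n - card W + 1) G" unfolding G_def by (rule nary_quasigroup_Q_op)
  ultimately show ?thesis unfolding W_separable_def by blast
qed

text \<open>
  The exchange property is applied to two unit vectors \<open>j\<close> and \<open>j'\<close> in \<open>W\<close>, with all \<open>y\<close> equal to
  \<open>0\<close> up to one, which compensates for the difference of the values of \<open>g\<close>; then a unit vector \<open>i\<close>
  outside of \<open>W\<close> is added to both.
\<close>

lemma Q_op_separable_differences:
  fixes g :: "'a::comm_ring_1 list \<Rightarrow> 'a"
  assumes sep: "W_separable m W (Q_op g a)" and W: "W \<subseteq> {..<m}"
    and i: "i < m" "i \<notin> W" and j: "j \<in> W" "j' \<in> W"
  shows "g (vec m (\<lambda>t. of_bool (t = i) + of_bool (t = j))) - g (vec m (\<lambda>t. of_bool (t = i) + of_bool (t = j'))) =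
    g (vec m (\<lambda>t. of_bool (t = j))) - g (vec m (\<lambda>t. of_bool (t = j')))"
proof -
  let ?u = "\<lambda>k. \<lambda>t. of_bool (t = k) :: 'a"
  let ?\<delta> = "g (vec m (?u j')) - g (vec m (?u j))"
  \<comment> \<open>The tuple with first components \<open>\<phi>\<close> whose second components vanish except for \<open>y\<close> at \<open>j'\<close>.\<close>
  let ?z = "\<lambda>\<phi> y. vec m (\<lambda>t. (\<phi> t, y * ?u j' t))"
  have Q: "Q_op g a (?z \<phi> y) = (- (\<Sum>t<m. \<phi> t) + a, - y + g (vec m \<phi>))" for \<phi> y
  proof -
    have "map fst (?z \<phi> y) = vec m \<phi>" "map snd (?z \<phi> y) = vec m (\<lambda>t. y * ?u j' t)"
      unfolding vec_def by simp_all
    moreover have "(\<Sum>t<m. y * ?u j' t) = y" using j W sum_unit(3)[of j' m "\<lambda>_. y"] by auto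
    ultimately show ?thesis unfolding Q_op_def by (simp only: sum_list_vec)
  qed
  have jm: "j < m" "j' < m" using j W by auto
  have "Q_op g a (?z (\<lambda>t. ?u i t + ?u j t) 0) = Q_op g a (?z (\<lambda>t. ?u i t + ?u j' t) ?\<delta>)"
  proof (rule W_separable_exchange[OF sep W, of "?z (?u j) 0" "?z (?u j') ?\<delta>"])
    show "Q_op g a (?z (?u j) 0) = Q_op g a (?z (?u j') ?\<delta>)"
      unfolding Q by (simp only: sum_unit(1)[OF jm(1)] sum_unit(1)[OF jm(2)]) simp
  qed (use i j in auto)
  then have "g (vec m (\<lambda>t. ?u i t + ?u j t)) = - ?\<delta> + g (vec m (\<lambda>t. ?u i t + ?u j' t))"
    unfolding Q by simp
  then show ?thesis by (simp add: algebra_simps)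
qed

text \<open>
  The first differences of a quadratic function in the direction from \<open>j'\<close> to \<open>j\<close> are affine
  in the base point.  Comparing two base points removes the linear coefficients, and also the
  diagonal ones if the base points agree at \<open>j\<close> and \<open>j'\<close>.
\<close>

lemma quadratic_unit_differences:
  fixes f :: "'a::comm_ring_1 list \<Rightarrow> 'a" and \<phi> \<psi> :: "nat \<Rightarrow> 'a"
  assumes f: "quadratic_coeffs n f c l m" and j: "j < n" "j' < n"
  shows "(f (vec n (\<lambda>t. \<phi> t + of_bool (t = j))) - f (vec n (\<lambda>t. \<phi> t + of_bool (t = j')))) -
      (f (vec n (\<lambda>t. \<psi> t + of_bool (t = j))) - f (vec n (\<lambda>t. \<psi> t + of_bool (t = j')))) =
    (\<Sum>t<n. (\<phi> t - \<psi> t) * (pair_coeff n m t j - pair_coeff n m t j'))"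
proof -
  let ?p = "pair_coeff n m"
  have shift: "f (vec n (\<lambda>t. \<theta> t + of_bool (t = k))) =
      f (vec n \<theta>) + f (vec n (\<lambda>t. of_bool (t = k))) - c + (\<Sum>s<n. \<theta> s * ?p s k)"
    if k: "k < n" for \<theta> and k
  proof -
    have "(\<Sum>t<n. ?p s t * (\<theta> s * of_bool (t = k))) = \<theta> s * ?p s k" for s
    proof -
      have "(\<Sum>t<n. ?p s t * (\<theta> s * of_bool (t = k))) = (\<Sum>t<n. (?p s t * \<theta> s) * of_bool (t = k))"
        by (intro sum.cong refl) (rule mult.assoc[symmetric])
      also have "\<dots> = ?p s k * \<theta> s" by (rule sum_unit(3)[OF k])
      finally show ?thesis by (simp only: mult.commute)
    qed
    then show ?thesis
      using quadratic_vec_add[OF f, of \<theta> "\<lambda>t. of_bool (t = k)"] by (simp only:)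
  qed
  have "(\<Sum>t<n. (\<phi> t - \<psi> t) * (?p t j - ?p t j')) =
      ((\<Sum>t<n. \<phi> t * ?p t j) - (\<Sum>t<n. \<phi> t * ?p t j')) -
      ((\<Sum>t<n. \<psi> t * ?p t j) - (\<Sum>t<n. \<psi> t * ?p t j'))"
    by (simp add: left_diff_distrib right_diff_distrib sum_subtractf)
  then show ?thesis unfolding shift[OF j(1)] shift[OF j(2)] by simp
qed

section \<open>Retracts and deletion of a vertex\<close>

lemma nths_remove_one:
  assumes "k < length xs"
  shows "nths xs (- {k}) = take k xs @ drop (Suc k) xs"
proof -
  have "nths xs (- {k}) = nths (take k xs @ xs ! k # drop (Suc k) xs) (- {k})"
    using assms by (simp flip: id_take_nth_drop)
  also have "\<dots> = nths (take k xs) (- {k}) @ nths (drop (Suc k) xs) {j. Suc j + k \<in> - {k}}"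
    using assms by (simp add: nths_append nths_Cons)
  also have "nths (take k xs) (- {k}) = take k xs" by (rule nths_all) auto
  also have "nths (drop (Suc k) xs) {j. Suc j + k \<in> - {k}} = drop (Suc k) xs" by (rule nths_all) auto
  finally show ?thesis .
qed

lemma is_retract_argument:
  fixes f :: "'a::comm_ring list \<Rightarrow> 'a"
  assumes k: "k < n"
  shows "is_retract n 1 (Q_op f a) (Q_op (\<lambda>xs. f (take k xs @ 0 # drop k xs)) a)"
  unfolding is_retract_def
proof (intro exI conjI allI impI)
  fix zs :: "('a \<times> 'a) list"
  assume "length zs = n \<and> (\<forall>i\<in>{k}. zs ! i = (\<lambda>_. (0, 0)) i)"
  then have kz: "k < length zs" "zs ! k = (0, 0)" using k by auto
  obtain ys ws where zs: "zs = ys @ (0, 0) # ws" "length ys = k"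
    using id_take_nth_drop[OF kz(1)] kz by (metis length_take min.absorb4)
  have "nths zs (- {k}) = ys @ ws" unfolding nths_remove_one[OF kz(1)] using zs by simp
  then show "Q_op (\<lambda>xs. f (take k xs @ 0 # drop k xs)) a (nths zs (- {k})) = Q_op f a zs"
    using zs by (simp add: Q_op_def)
qed (use k in auto)

text \<open>
  The inverse in the last place is again of the form \<open>Q_op\<close>: it feeds \<open>f\<close> with the last argument
  that is computed from the given value.  Here the value is fixed to be \<open>(0, 0)\<close>.
\<close>

lemma is_retract_output:
  fixes f :: "'a::comm_ring list \<Rightarrow> 'a"
  assumes n: "0 < n"
  shows "is_retract n 1 (Q_op f a) (Q_op (\<lambda>xs. f (xs @ [a - sum_list xs])) a)"
proof -
  define Q' where "Q' = Q_op (\<lambda>xs. f (butlast xs @ [a - sum_list xs])) a"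
  have split_last: "\<exists>ys z. zs = ys @ [z] \<and> length ys = n - 1" if "length zs = n" for zs :: "('a \<times> 'a) list"
    using n that by (intro exI[of _ "butlast zs"] exI[of _ "last zs"]) auto
  have "is_inverse_at n (n - 1) (Q_op f a) Q'"
    unfolding is_inverse_at_def
  proof (intro conjI allI impI)
    show "nary_quasigroup n Q'" unfolding Q'_def by (rule nary_quasigroup_Q_op)
    fix zs :: "('a \<times> 'a) list" and x0 :: "'a \<times> 'a" assume "length zs = n"
    then obtain ys z where zs: "zs = ys @ [z]" "length ys = n - 1" using split_last by blast
    have upd: "zs[n - 1 := x0] = ys @ [x0]" "zs ! (n - 1) = z"
      using zs by (simp_all add: list_update_append nth_append)
    show "(x0 = Q_op f a zs) = (zs ! (n - 1) = Q' (zs[n - 1 := x0]))"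
      unfolding upd unfolding zs(1) Q'_def Q_op_def by (auto simp: prod_eq_iff algebra_simps)
  qed
  moreover have "Q_op (\<lambda>xs. f (xs @ [a - sum_list xs])) a (nths zs (- {n - 1})) = Q' zs"
    if zn: "length zs = n" and z0: "zs ! (n - 1) = (0, 0)" for zs
  proof -
    obtain ys z where zs: "zs = ys @ [z]" "length ys = n - 1" using split_last[OF zn] by blast
    have "z = (0, 0)" using z0 zs by (simp add: nth_append)
    moreover have "nths zs (- {n - 1}) = ys" using n zn zs by (simp add: nths_remove_one)
    ultimately show ?thesis unfolding Q'_def Q_op_def zs(1) by simp
  qed
  ultimately show ?thesis unfolding is_retract_def using n
    by (intro exI[of _ Q'] exI[of _ "{n - 1}"] exI[of _ "\<lambda>_. (0, 0)"]) auto
qed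

text \<open>
  Vertex \<open>n\<close> stands for the value of the quasigroup, the vertices below \<open>n\<close> for its arguments.
\<close>

locale quadratic_quasigroup =
  fixes f :: "'a::comm_ring_1 list \<Rightarrow> 'a" and a :: 'a and n :: nat and c l m
  assumes coeffs: "quadratic_coeffs n f c l m"
    and double_eq_0: "x + x = (0::'a) \<Longrightarrow> x = 0"
begin

sublocale edge_weights "pair_coeff n m"
  by unfold_locales (auto simp: pair_coeff_def add.commute double_eq_0)

lemma pair_coeff_output [simp]: "pair_coeff n m n j = 0" "pair_coeff n m i n = 0"
  unfolding pair_coeff_def by simp_all

text \<open>
  Of the two parts of a split, \<open>W\<close> has to be the one without the vertex \<open>n\<close>.
\<close>

lemma separable_if_split:
  assumes "split {..n} A"
  shows "separable n (Q_op f a)"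
proof -
  obtain W where W: "split {..n} W" "n \<notin> W"
    using assms split_compl[OF assms] by (cases "n \<in> A") auto
  have Wn: "W \<subseteq> {..<n}" using W unfolding split_def by (auto simp: le_less subset_iff)
  have card: "2 \<le> card W" "2 \<le> card ({..n} - W)" using W(1) unfolding split_def by auto
  have "card ({..n} - W) = Suc n - card W"
    using Wn by (subst card_Diff_subset) (auto intro: finite_subset)
  then have "card W \<le> n - 1" using card(2) by simp
  obtain w where w: "w \<in> W" using card(1) by fastforce
  have "pair_coeff n m i j = pair_coeff n m i w" if "i < n" "i \<notin> W" "j \<in> W" for i j
  proof -
    have "cross j w i n = 0" using W w that unfolding split_def by auto
    then show ?thesis unfolding cross_def by (simp add: sym)
  qed
  then have "W_separable n W (Q_op f a)"
    using W_separable_Q_op[OF coeffs Wn, of "\<lambda>i. pair_coeff n m i w"] by blast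
  then show ?thesis unfolding separable_def using Wn card(1) \<open>card W \<le> n - 1\<close> by blast
qed

text \<open>
  The renumbering \<open>\<sigma>\<close> skips the argument \<open>k\<close>; the value of the retract is still the vertex \<open>n\<close>.
\<close>

lemma split_if_argument_retract_separable:
  assumes k: "k < n" and sep: "separable (n - 1) (Q_op (\<lambda>xs. f (take k xs @ 0 # drop k xs)) a)"
  shows "\<exists>A. split ({..n} - {k}) A"
proof -
  let ?g = "\<lambda>xs. f (take k xs @ 0 # drop k xs)"
  obtain W where W: "W \<subseteq> {..<n - 1}" "2 \<le> card W" "card W \<le> n - 1 - 1" "W_separable (n - 1) W (Q_op ?g a)"
    using sep unfolding separable_def by blast
  define \<sigma> where "\<sigma> t = (if t < k then t else Suc t)" for t
  have inj: "inj \<sigma>" unfolding \<sigma>_def inj_def by auto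
  have \<sigma>n: "\<sigma> t < n" if "t < n - 1" for t using that unfolding \<sigma>_def by auto
  have \<sigma>k: "\<sigma> t \<noteq> k" for t unfolding \<sigma>_def by auto
  have \<sigma>_onto: "\<exists>s<n - 1. t = \<sigma> s" if "t < n" "t \<noteq> k" for t
    using that k unfolding \<sigma>_def by (intro exI[of _ "if t < k then t else t - 1"]) auto
  have insert0: "take k (vec (n - 1) \<theta>) @ 0 # drop k (vec (n - 1) \<theta>) = vec n \<psi>"
    if "\<And>t. t < n - 1 \<Longrightarrow> \<theta> t = \<psi> (\<sigma> t)" "\<psi> k = 0" for \<theta> \<psi> :: "nat \<Rightarrow> 'a"
  proof (rule nth_equalityI)
    show "length (take k (vec (n - 1) \<theta>) @ 0 # drop k (vec (n - 1) \<theta>)) = length (vec n \<psi>)"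
      using k by simp
    fix t assume "t < length (take k (vec (n - 1) \<theta>) @ 0 # drop k (vec (n - 1) \<theta>))"
    then have t: "t < n" using k by simp
    consider "t < k" | "t = k" | "k < t" by linarith
    then show "(take k (vec (n - 1) \<theta>) @ 0 # drop k (vec (n - 1) \<theta>)) ! t = vec n \<psi> ! t"
    proof cases
      case 1
      then show ?thesis using that(1)[of t] k t by (simp add: nth_append \<sigma>_def)
    next
      case 2
      then show ?thesis using that(2) k t by (simp add: nth_append)
    next
      case 3
      then obtain s where "t = Suc s" by (cases t) auto
      then show ?thesis using that(1)[of s] k t 3 by (simp add: nth_append \<sigma>_def nth_Cons')
    qed
  qed
  have diff: "pair_coeff n m (\<sigma> i) (\<sigma> j) = pair_coeff n m (\<sigma> i) (\<sigma> j')"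
    if i: "i < n - 1" "i \<notin> W" and j: "j \<in> W" "j' \<in> W" for i j j'
  proof -
    have jn: "j < n - 1" "j' < n - 1" using j W(1) by auto
    have two: "?g (vec (n - 1) (\<lambda>t. of_bool (t = i) + of_bool (t = s))) =
        f (vec n (\<lambda>t. of_bool (t = \<sigma> i) + of_bool (t = \<sigma> s)))" for s
      using \<sigma>k inj by (subst insert0) (auto simp: inj_eq)
    have one: "?g (vec (n - 1) (\<lambda>t. of_bool (t = s))) = f (vec n (\<lambda>t. 0 + of_bool (t = \<sigma> s)))" for s
      using \<sigma>k inj by (subst insert0) (auto simp: inj_eq)
    have "(\<Sum>t<n. (of_bool (t = \<sigma> i) - 0) * (pair_coeff n m t (\<sigma> j) - pair_coeff n m t (\<sigma> j'))) = 0"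
      using Q_op_separable_differences[OF W(4,1) i j]
      unfolding two one by (subst quadratic_unit_differences[OF coeffs, symmetric]) (use \<sigma>n jn in auto)
    then show ?thesis
      using sum_unit(2)[OF \<sigma>n[OF i(1)], of "\<lambda>t. pair_coeff n m t (\<sigma> j) - pair_coeff n m t (\<sigma> j')"] by simp
  qed
  have A: "\<sigma> ` W \<subseteq> {..n} - {k}" using \<sigma>n \<sigma>k W(1) by (fastforce simp: less_imp_le)
  have cardA: "card (\<sigma> ` W) = card W" using inj by (meson card_image inj_on_subset subset_UNIV)
  have finW: "finite W" using W(1) finite_subset by blast
  have "split ({..n} - {k}) (\<sigma> ` W)"
  proof (rule splitI[where p = n])
    have "card ({..n} - {k} - \<sigma> ` W) = n - card W"
      using A cardA k finW by (subst card_Diff_subset) auto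
    then show "2 \<le> card ({..n} - {k} - \<sigma> ` W)" using W(2,3) by linarith
    fix i j j' assume i: "i \<in> {..n} - {k} - \<sigma> ` W" and j: "j \<in> \<sigma> ` W" "j' \<in> \<sigma> ` W"
    show "cross i n j j' = 0"
    proof (cases "i = n")
      case False
      then obtain s where s: "s < n - 1" "i = \<sigma> s" using \<sigma>_onto[of i] i by auto
      obtain t t' where "t \<in> W" "j = \<sigma> t" "t' \<in> W" "j' = \<sigma> t'" using j by blast
      moreover have "s \<notin> W" using i s by auto
      ultimately show ?thesis using diff[of s t t'] s unfolding cross_def by simp
    qed simp
  qed (use A cardA W in auto)
  then show ?thesis by blast
qed

text \<open>
  The value of this retract is the last argument of the original quasigroup, hence the vertex
  \<open>n - 1\<close>.  It changes along with the arguments, and this gives the terms of the cross difference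
  that contain \<open>n - 1\<close>.
\<close>

lemma split_if_output_retract_separable:
  assumes n: "2 \<le> n" and sep: "separable (n - 1) (Q_op (\<lambda>xs. f (xs @ [a - sum_list xs])) a)"
  shows "\<exists>A. split ({..n} - {n}) A"
proof -
  let ?g = "\<lambda>xs. f (xs @ [a - sum_list xs])"
  let ?o = "n - 1"
  obtain W where W: "W \<subseteq> {..<n - 1}" "2 \<le> card W" "card W \<le> n - 1 - 1" "W_separable (n - 1) W (Q_op ?g a)"
    using sep unfolding separable_def by blast
  have append: "vec (n - 1) \<theta> @ [x] = vec n \<psi>"
    if "\<And>t. t < n - 1 \<Longrightarrow> \<theta> t = \<psi> t" "\<psi> ?o = x" for \<theta> \<psi> :: "nat \<Rightarrow> 'a" and x
  proof (rule nth_equalityI)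
    fix t assume "t < length (vec (n - 1) \<theta> @ [x])"
    then have "t < n - 1 \<or> t = n - 1" by auto
    then show "(vec (n - 1) \<theta> @ [x]) ! t = vec n \<psi> ! t"
      using that n by (auto simp: nth_append)
  qed (use n in simp)
  have diff: "cross i ?o j j' = 0"
    if i: "i < n - 1" "i \<notin> W" and j: "j \<in> W" "j' \<in> W" for i j j'
  proof -
    let ?p = "pair_coeff n m"
    have jn: "j < n - 1" "j' < n - 1" using j W(1) by auto
    have two: "?g (vec (n - 1) (\<lambda>t. of_bool (t = i) + of_bool (t = s))) =
        f (vec n (\<lambda>t. (of_bool (t = i) + (a - 2) * of_bool (t = ?o)) + of_bool (t = s)))" if "s < n - 1" for s
      using i that by (subst append) (auto simp: sum_list_vec sum.distrib sum_unit(1) simp del: sum_of_bool_eq)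
    have one: "?g (vec (n - 1) (\<lambda>t. of_bool (t = s))) =
        f (vec n (\<lambda>t. (a - 1) * of_bool (t = ?o) + of_bool (t = s)))" if "s < n - 1" for s
      using that by (subst append) (auto simp: sum_list_vec sum_unit(1) simp del: sum_of_bool_eq)
    have "0 = (\<Sum>t<n. ((of_bool (t = i) + (a - 2) * of_bool (t = ?o)) - (a - 1) * of_bool (t = ?o)) *
        (?p t j - ?p t j'))"
      using Q_op_separable_differences[OF W(4,1) i j]
      unfolding two[OF jn(1)] two[OF jn(2)] one[OF jn(1)] one[OF jn(2)]
      by (subst quadratic_unit_differences[OF coeffs, symmetric]) (use jn in auto)
    also have "\<dots> = (\<Sum>t<n. of_bool (t = i) * (?p t j - ?p t j') - of_bool (t = ?o) * (?p t j - ?p t j'))"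
      by (intro sum.cong refl) (simp add: algebra_simps)
    also have "\<dots> = (?p i j - ?p i j') - (?p ?o j - ?p ?o j')"
      using sum_unit(2)[of i n "\<lambda>t. ?p t j - ?p t j'"] sum_unit(2)[of ?o n "\<lambda>t. ?p t j - ?p t j'"] i n
      by (simp add: sum_subtractf)
    finally show ?thesis unfolding cross_def by (simp add: algebra_simps)
  qed
  have finW: "finite W" using W(1) finite_subset by blast
  have sub: "W \<subseteq> {..n} - {n}" using W(1) by auto
  have "split ({..n} - {n}) W"
  proof (rule splitI[where p = ?o])
    have "card ({..n} - {n} - W) = n - card W"
      using sub finW by (subst card_Diff_subset) auto
    then show "2 \<le> card ({..n} - {n} - W)" using W(2,3) by linarith
    fix i j j' assume i: "i \<in> {..n} - {n} - W" and j: "j \<in> W" "j' \<in> W"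
    show "cross i ?o j j' = 0"
    proof (cases "i = ?o")
      case False
      then show ?thesis using diff[of i j j'] i j by auto
    qed simp
  qed (use sub W in auto)
  then show ?thesis by blast
qed

end

theorem mainTheorem5:
  fixes f :: "'q::prime_card mod_ring list \<Rightarrow> 'q mod_ring"
    and a :: "'q mod_ring"
    and n :: nat
  assumes "CARD('q) > 2"
    and "n \<ge> 2"
    and "quadratic n f"
    and "\<And>R. is_retract n 1 (Q_op f a) R \<Longrightarrow> separable (n - 1) R"
  shows "separable n (Q_op f a)"
proof (rule ccontr)
  assume not_sep: "\<not> separable n (Q_op f a)"
  obtain c l m where coeffs: "quadratic_coeffs n f c l m" using quadratic_has_coeffs[OF assms(3)] .
  have "\<not> CARD('q) dvd 2" using assms(1) by (auto dest: dvd_imp_le)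
  then have "(of_nat 2 :: 'q mod_ring) \<noteq> 0" by (simp only: of_nat_eq_0_iff_char_dvd semiring_char_mod_ring not_False_eq_True)
  then have two: "(2 :: 'q mod_ring) \<noteq> 0" by simp
  interpret quadratic_quasigroup f a n c l m
  proof
    show "x = 0" if "x + x = 0" for x :: "'q mod_ring"
      using that two by (simp flip: mult_2)
  qed (rule coeffs)
  have arg: "separable (n - 1) (Q_op (\<lambda>xs. f (take k xs @ 0 # drop k xs)) a)" if "k < n" for k
    using assms(4) is_retract_argument[OF that] by blast
  have out: "separable (n - 1) (Q_op (\<lambda>xs. f (xs @ [a - sum_list xs])) a)"
    using assms(2,4) is_retract_output[of n f a] by simp
  \<comment> \<open>A separable quasigroup has arity at least three, which settles small \<open>n\<close>.\<close>
  then have "4 \<le> n" unfolding separable_def by auto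
  have "prime_set {..n}"
    using \<open>4 \<le> n\<close> not_sep separable_if_split unfolding prime_set_def by auto
  then obtain k where k: "k \<in> {..n}" "prime_set ({..n} - {k})"
    using prime_set_removable[of "{..n}"] \<open>4 \<le> n\<close> by auto
  have "\<exists>A. split ({..n} - {k}) A"
    using split_if_argument_retract_separable[of k] arg[of k]
      split_if_output_retract_separable[OF assms(2) out] k(1) by (cases "k = n") auto
  then show False using k(2) unfolding prime_set_def by blast
qed

end
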